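(* Let $(R,pR)$ be a discrete valuation domain with valuation $\mathsf{v}$ and $q=|R/pR|<\infty$. Let $f\in R[x]$ be a non-constant primitive polynomial with irreducible divisor set $\mathcal{P}$, $f=\prod_{g\in\mathcal{P}}g^{m_g}$ with $m_g\in\mathbb{N}$, and $n:=\mathsf{v}(\operatorname{d}(f))\in\mathbb{N}$ (so $n\ge1$); set $F=\frac{f}{p^n}$. Let $W\subseteq\mathcal{W}(f)$ be finite such that the matrix $A\in\mathbb{Q}^{W\times\mathcal{P}}$ whose row indexed by $w\in W$ is $\mathsf{v}_{\mathcal{P}}(w)$ has $\mathbb{Q}$-linearly independent rows and satisfies $\ker(A)=\operatorname{fdk}(f)$, and let $u$ be the number of rows of $A$ with exactly one non-zero entry. Assume $F$ is irreducible in $\operatorname{Int}(R)$. Then the following are equivalent: (1) $F$ is absolutely irreducible in $\operatorname{Int}(R)$; (2) $F^S$ factors uniquely in $\operatorname{Int}(R)$ for $S=2(n+1)\,n^{q^{\lceil n/2\rceil}}$; (3) $F^S$ factors uniquely in $\operatorname{Int}(R)$ for $S=2(n+1)\,n^{\operatorname{rank}(A)-u}$.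
   Context: $(R,pR)$ is a discrete valuation domain with valuation $\mathsf{v}$, finite residue field, and quotient field $K$. $\operatorname{Int}(R)=\{F\in K[x]\mid F(R)\subseteq R\}$. For $f\in R[x]$, $\operatorname{d}(f)=\gcd(f(a)\mid a\in R)$, so $\mathsf{v}(\operatorname{d}(f))=\min_{a\in R}\mathsf{v}(f(a))$. Primitive means the coefficients generate $R$. An irreducible divisor set $\mathcal{P}$ of $f$ is a set of representatives of the associate classes of irreducible divisors of $f$ in $R[x]$. For $a\in R$, $\mathsf{v}_{\mathcal{P}}(a)=(\mathsf{v}(g(a)))_{g\in\mathcal{P}}$. $\mathcal{W}(f)=\{a\in R\mid \mathsf{v}(f(a))=\mathsf{v}(\operatorname{d}(f))\}$, and $$\operatorname{fdk}(f)=\Big\{(u_g)_{g\in\mathcal{P}}\in\mathbb{Q}^{\mathcal{P}}\ \Big|\ \forall a\in\mathcal{W}(f):\ \textstyle\sum_{g\in\mathcal{P}}u_g\,\mathsf{v}(g(a))=0\Big\}.$$ An element "factors uniquely" if all its factorizations into irreducibles are essentially the same (same number of factors, pairwise associated after reindexing). An irreducible $r$ is absolutely irreducible if $r^k$ factors uniquely (as $r\cdots r$) for every $k\in\mathbb{N}$. *)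

theory Defs
  imports "HOL-Computational_Algebra.Polynomial_Factorial" "HOL-Library.Extended_Nat"
begin

text \<open>The whole type 'a is the DVR R; p is a uniformizer (pR is the maximal ideal):
  p is a nonzero non-unit and every nonzero element is a unit times a power of p.\<close>
definition dvr :: "'a::idom \<Rightarrow> bool" where
  "dvr p \<longleftrightarrow> p \<noteq> 0 \<and> \<not> p dvd 1 \<and>
     (\<forall>a. a \<noteq> 0 \<longrightarrow> (\<exists>e k. e dvd 1 \<and> a = e * p ^ k))"

text \<open>Congruence modulo pR; its quotient UNIV // resrel p is the residue field R/pR.\<close>
definition resrel :: "'a::idom \<Rightarrow> ('a \<times> 'a) set" where
  "resrel p = {(a, b). p dvd (a - b)}"

definition pmult :: "'a::idom \<Rightarrow> 'a \<Rightarrow> nat" where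
  "pmult p a = Max {k. p ^ k dvd a}"

definition vval :: "'a::idom \<Rightarrow> 'a \<Rightarrow> enat" where
  "vval p a = (if a = 0 then \<infinity> else enat (pmult p a))"

definition vd :: "'a::idom \<Rightarrow> 'a poly \<Rightarrow> enat" where
  "vd p f = (INF a. vval p (poly f a))"

definition Wset :: "'a::idom \<Rightarrow> 'a poly \<Rightarrow> 'a set" where
  "Wset p f = {a. vval p (poly f a) = vd p f}"

definition primitive :: "'a::idom poly \<Rightarrow> bool" where
  "primitive f \<longleftrightarrow> (\<exists>c. (\<Sum>i\<le>degree f. c i * coeff f i) = 1)"

definition irr_divisor_set :: "'a::idom poly \<Rightarrow> 'a poly set \<Rightarrow> bool" where
  "irr_divisor_set f P \<longleftrightarrow> (\<forall>g\<in>P. irreducible g \<and> g dvd f) \<and>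
     (\<forall>h. irreducible h \<and> h dvd f \<longrightarrow> (\<exists>!g. g \<in> P \<and> h dvd g \<and> g dvd h))"

definition IntR :: "'a::idom fract poly set" where
  "IntR = {F. \<forall>a. poly F (to_fract a) \<in> range to_fract}"

section \<open>Factorization notions in a multiplicatively closed subset S (here Int(R))\<close>

definition unit_in :: "'b::comm_ring_1 set \<Rightarrow> 'b \<Rightarrow> bool" where
  "unit_in S x \<longleftrightarrow> x \<in> S \<and> (\<exists>y\<in>S. x * y = 1)"

definition assoc_in :: "'b::comm_ring_1 set \<Rightarrow> 'b \<Rightarrow> 'b \<Rightarrow> bool" where
  "assoc_in S x y \<longleftrightarrow> (\<exists>e. unit_in S e \<and> x = e * y)"

definition irred_in :: "'b::comm_ring_1 set \<Rightarrow> 'b \<Rightarrow> bool" where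
  "irred_in S x \<longleftrightarrow> x \<in> S \<and> x \<noteq> 0 \<and> \<not> unit_in S x \<and>
     (\<forall>a\<in>S. \<forall>b\<in>S. x = a * b \<longrightarrow> unit_in S a \<or> unit_in S b)"

definition factorization_in :: "'b::comm_ring_1 set \<Rightarrow> 'b \<Rightarrow> 'b list \<Rightarrow> bool" where
  "factorization_in S x xs \<longleftrightarrow> (\<forall>y\<in>set xs. irred_in S y) \<and> prod_list xs = x"

definition factors_uniquely_in :: "'b::comm_ring_1 set \<Rightarrow> 'b \<Rightarrow> bool" where
  "factors_uniquely_in S x \<longleftrightarrow>
     (\<forall>xs ys. factorization_in S x xs \<and> factorization_in S x ys \<longrightarrow>
        length xs = length ys \<and>
        (\<exists>\<sigma>. bij_betw \<sigma> {..<length xs} {..<length ys} \<and>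
             (\<forall>i<length xs. assoc_in S (xs ! i) (ys ! \<sigma> i))))"

definition abs_irred_in :: "'b::comm_ring_1 set \<Rightarrow> 'b \<Rightarrow> bool" where
  "abs_irred_in S r \<longleftrightarrow> irred_in S r \<and> (\<forall>k::nat. factors_uniquely_in S (r ^ k))"

definition vmat :: "'a::idom \<Rightarrow> 'a \<Rightarrow> 'a poly \<Rightarrow> rat" where
  "vmat p w g = of_nat (pmult p (poly g w))"

definition rows_indep :: "('w \<Rightarrow> 'c \<Rightarrow> rat) \<Rightarrow> 'w set \<Rightarrow> 'c set \<Rightarrow> bool" where
  "rows_indep M Wr C \<longleftrightarrow>
     (\<forall>c. (\<forall>j\<in>C. (\<Sum>i\<in>Wr. c i * M i j) = 0) \<longrightarrow> (\<forall>i\<in>Wr. c i = 0))"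

definition mat_rank :: "('w \<Rightarrow> 'c \<Rightarrow> rat) \<Rightarrow> 'w set \<Rightarrow> 'c set \<Rightarrow> nat" where
  "mat_rank M Wr C = Max {card V | V. V \<subseteq> Wr \<and> rows_indep M V C}"

end

theory Submission
  imports Defs "HOL-Library.FuncSet"
begin

text \<open>Write \<open>v g a\<close> for the valuation of \<open>g(a)\<close>. By Gauss's lemma, a divisor of \<open>F\<^sup>k\<close> in
  \<open>Int(R)\<close> is, up to units, \<open>p\<^sup>-\<^sup>e \<Prod> g\<^bsup>a(g)\<^esup>\<close> with \<open>a \<le> k m\<close>, and evaluating at
  \<open>w \<in> \<W>(f)\<close> gives \<open>\<Sum> a(g) v g w = e\<close>, that is, \<open>n a - e m\<close> lies in \<open>fdk(f)\<close>.
  If \<open>fdk(f) = 0\<close>, then \<open>n a = e m\<close>, and an irreducible divisor can only be \<open>F\<close> itself.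
  Conversely, an integral \<open>z \<noteq> 0\<close> in \<open>fdk(f)\<close> with entries bounded by \<open>b\<close> gives, with
  \<open>k = (n + 1) b\<close>, a second factorization of \<open>F\<^bsup>2k\<^esup>\<close> from the product of the elements
  \<open>p\<^bsup>-kn\<^esup> \<Prod> g\<^bsup>k m(g) \<plusminus> z(g)\<^esup>\<close> of \<open>Int(R)\<close>. After deleting the rows of \<open>A\<close> with a single nonzero
  entry, a pigeonhole argument gives such a \<open>z\<close> with \<open>b = n\<^bsup>rank A - u\<^esup>\<close>. Finally, the row
  of \<open>w\<close> depends only on \<open>w\<close> modulo \<open>p\<^bsup>\<lceil>n/2\<rceil>\<^esup>\<close>, hence \<open>rank A \<le> q\<^bsup>\<lceil>n/2\<rceil>\<^esup>\<close>.\<close>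

subsection \<open>Small integer kernel vectors\<close>

text \<open>Siegel's lemma by the pigeonhole principle: with \<open>N = n ^ card I\<close>, the box
  \<open>{0..N}\<^sup>J\<close> has more points than the box \<open>{0..nN}\<^sup>I\<close> into which it is mapped.\<close>
lemma small_integer_kernel_vector:
  fixes M :: "'i \<Rightarrow> 'j \<Rightarrow> nat" and n :: nat
  assumes fin: "finite I" "finite J" and card: "card I < card J" and n: "n \<ge> 1"
    and rows: "\<And>i. i \<in> I \<Longrightarrow> (\<Sum>j\<in>J. M i j) \<le> n"
  shows "\<exists>z :: 'j \<Rightarrow> int. (\<exists>j\<in>J. z j \<noteq> 0) \<and> (\<forall>j. \<bar>z j\<bar> \<le> int (n ^ card I)) \<and>
    (\<forall>i\<in>I. (\<Sum>j\<in>J. int (M i j) * z j) = 0)"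
proof -
  define r where "r = card I"
  define N where "N = n ^ r"
  have N: "N \<ge> 1" using n by (simp add: N_def)
  let ?D = "J \<rightarrow>\<^sub>E {0..N}" and ?C = "I \<rightarrow>\<^sub>E {0..n * N}"
  let ?h = "\<lambda>x. \<lambda>i\<in>I. \<Sum>j\<in>J. M i j * x j"
  have maps: "?h ` ?D \<subseteq> ?C"
  proof (clarsimp simp: PiE_iff)
    fix x i assume x: "\<forall>j\<in>J. x j \<le> N" and i: "i \<in> I"
    have "(\<Sum>j\<in>J. M i j * x j) \<le> (\<Sum>j\<in>J. M i j * N)"
      using x by (intro sum_mono mult_left_mono) auto
    also have "\<dots> = (\<Sum>j\<in>J. M i j) * N" by (simp add: sum_distrib_right)
    also have "\<dots> \<le> n * N" using rows[OF i] by simp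
    finally show "(\<Sum>j\<in>J. M i j * x j) \<le> n * N" .
  qed
  have "card ?C = (n * N + 1) ^ r" using fin by (simp add: card_funcsetE r_def)
  \<comment> \<open>As \<open>n >= 1\<close>, \<open>n * N + 1 <= n * (N + 1)\<close>. The factor
    \<open>n ^ r\<close> that comes out is \<open>N\<close> by choice, and \<open>N < N + 1\<close>
    gives the strict inequality.\<close>
  also have "\<dots> \<le> (n * (N + 1)) ^ r" using n by (intro power_mono) auto
  also have "\<dots> = N * (N + 1) ^ r" by (simp only: power_mult_distrib N_def)
  also have "\<dots> < (N + 1) ^ Suc r" by simp
  also have "\<dots> \<le> (N + 1) ^ card J" using card by (intro power_increasing) (auto simp: r_def)
  also have "\<dots> = card ?D" using fin by (simp add: card_funcsetE)
  finally have "card ?C < card ?D" .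
  moreover have "finite ?C" using fin by (intro finite_PiE) auto
  ultimately have "card (?h ` ?D) < card ?D"
    using card_mono[OF _ maps] by simp
  then have "\<not> inj_on ?h ?D" by (rule pigeonhole)
  then obtain x y where xy: "x \<in> ?D" "y \<in> ?D" "?h x = ?h y" "x \<noteq> y"
    by (auto simp: inj_on_def)
  \<comment> \<open>The difference of two colliding points, set to 0 outside \<open>J\<close>, where
    \<open>x\<close> and \<open>y\<close> are \<open>undefined\<close>; so the bound holds at every
    \<open>j\<close>.\<close>
  define z where "z = (\<lambda>j. if j \<in> J then int (x j) - int (y j) else 0)"
  show ?thesis
  proof (intro exI[of _ z] conjI allI ballI)
    show "\<exists>j\<in>J. z j \<noteq> 0"
    proof (rule ccontr)
      assume "\<not> (\<exists>j\<in>J. z j \<noteq> 0)"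
      then have "x = y" using xy(1,2) by (intro PiE_ext[of x J _ y]) (auto simp: z_def)
      with xy(4) show False ..
    qed
    show "\<bar>z j\<bar> \<le> int (n ^ card I)" for j
      using PiE_mem[OF xy(1), of j] PiE_mem[OF xy(2), of j]
      by (auto simp: z_def N_def r_def abs_if simp flip: of_nat_power)
    show "(\<Sum>j\<in>J. int (M i j) * z j) = 0" if "i \<in> I" for i
    proof -
      have "(\<Sum>j\<in>J. M i j * x j) = (\<Sum>j\<in>J. M i j * y j)"
        using fun_cong[OF xy(3), of i] that by simp
      then have "int (\<Sum>j\<in>J. M i j * x j) = int (\<Sum>j\<in>J. M i j * y j)" by simp
      then show ?thesis by (simp add: z_def algebra_simps sum_subtractf)
    qed
  qed
qed

text \<open>Otherwise there are more rows than columns other than \<open>k\<close>, and the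
  pigeonhole lemma for the transposed matrix gives a nontrivial relation between the rows away from
  column \<open>k\<close>. Pairing it with the kernel vector \<open>u\<close> extends the relation
  to column \<open>k\<close>, because \<open>u k\<close> is nonzero. This contradicts
  independence.\<close>

lemma rows_indep_card_less:
  fixes M :: "'i \<Rightarrow> 'j \<Rightarrow> nat" and u :: "'j \<Rightarrow> rat"
  assumes fin: "finite I" "finite J" and indep: "rows_indep (\<lambda>i j. of_nat (M i j)) I J"
    and u: "\<And>i. i \<in> I \<Longrightarrow> (\<Sum>j\<in>J. of_nat (M i j) * u j) = 0" and k: "k \<in> J" "u k \<noteq> 0"
  shows "card I < card J"
proof (rule ccontr)
  assume "\<not> card I < card J"
  moreover have "card (J - {k}) < card J" using fin k by (intro card_Diff1_less)
  ultimately have less: "card (J - {k}) < card I" by linarith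
  \<comment> \<open>Any positive bound for the column sums will do; only the existence of
    \<open>z\<close> matters here, not its size.\<close>
  define b where "b = Suc (\<Sum>j\<in>J. \<Sum>i\<in>I. M i j)"
  have b: "b \<ge> 1" by (simp add: b_def)
  moreover have "(\<Sum>i\<in>I. M i j) \<le> b" if "j \<in> J - {k}" for j
    using member_le_sum[of j J "\<lambda>j. \<Sum>i\<in>I. M i j"] that fin by (simp add: b_def)
  ultimately obtain z where z: "\<exists>i\<in>I. z i \<noteq> 0"
      "\<And>j. j \<in> J - {k} \<Longrightarrow> (\<Sum>i\<in>I. int (M i j) * z i) = 0"
    using small_integer_kernel_vector[OF _ fin(1) less, of b "\<lambda>j i. M i j"] fin(2) by auto
  have col: "(\<Sum>i\<in>I. of_int (z i) * of_nat (M i j)) = (of_int (\<Sum>i\<in>I. int (M i j) * z i) :: rat)" for j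
    by (simp add: mult.commute)
  have other: "(\<Sum>i\<in>I. of_int (z i) * of_nat (M i j)) = (0::rat)" if "j \<in> J - {k}" for j
    unfolding col using z(2)[OF that] by simp
  have "(0::rat) = (\<Sum>i\<in>I. of_int (z i) * (\<Sum>j\<in>J. of_nat (M i j) * u j))"
    using u by simp
  also have "\<dots> = (\<Sum>i\<in>I. \<Sum>j\<in>J. u j * (of_int (z i) * of_nat (M i j)))"
    by (simp add: sum_distrib_left algebra_simps)
  also have "\<dots> = (\<Sum>j\<in>J. \<Sum>i\<in>I. u j * (of_int (z i) * of_nat (M i j)))" by (rule sum.swap)
  also have "\<dots> = (\<Sum>j\<in>J. u j * (\<Sum>i\<in>I. of_int (z i) * of_nat (M i j)))"
    by (simp add: sum_distrib_left)
  also have "\<dots> = u k * (\<Sum>i\<in>I. of_int (z i) * of_nat (M i k))"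
    using other fin k by (subst sum.remove[of J k]) auto
  finally have "(\<Sum>i\<in>I. of_int (z i) * of_nat (M i k)) = (0::rat)" using k by simp
  with other have "\<forall>j\<in>J. (\<Sum>i\<in>I. of_int (z i) * of_nat (M i j)) = (0::rat)" by auto
  with indep have "\<forall>i\<in>I. (of_int (z i) :: rat) = 0" unfolding rows_indep_def
    by (elim allE[where x = "\<lambda>i. of_int (z i)"] impE)
  with z(1) show False by simp
qed

text \<open>The relation extends to all of \<open>I\<close> by zero coefficients. The lemma serves
  to exclude proportional rows and equal rows.\<close>

lemma rows_indep_two_rows:
  assumes indep: "rows_indep M I J" and fin: "finite I" and ij: "i \<in> I" "j \<in> I" "i \<noteq> j"
    and eq: "\<And>k. k \<in> J \<Longrightarrow> a * M i k + b * M j k = 0"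
  shows "a = 0" "b = 0"
proof -
  define c where "c = (\<lambda>l. if l = i then a else if l = j then b else 0)"
  have "(\<Sum>l\<in>I. c l * M l k) = 0" if "k \<in> J" for k
  proof -
    have "(\<Sum>l\<in>I. c l * M l k) = (\<Sum>l\<in>{i, j}. c l * M l k)"
      using ij fin by (intro sum.mono_neutral_right) (auto simp: c_def)
    also have "\<dots> = 0" using ij eq[OF that] by (simp add: c_def)
    finally show ?thesis .
  qed
  then have "\<forall>l\<in>I. c l = 0" using indep unfolding rows_indep_def by blast
  then show "a = 0" "b = 0" using ij by (auto simp: c_def split: if_splits)
qed

lemma rows_indep_mat_rank:
  assumes "finite I" "rows_indep M I J"
  shows "mat_rank M I J = card I"
  unfolding mat_rank_def
proof (rule Max_eqI)
  show "finite {card V |V. V \<subseteq> I \<and> rows_indep M V J}"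
    using assms(1) by auto
qed (use assms card_mono in auto)

text \<open>A row with a single nonzero entry forces that coordinate of a kernel vector to vanish, so
  such rows can be deleted together with their columns.\<close>
lemma small_integer_kernel_vector_rank:
  fixes M :: "'i \<Rightarrow> 'j \<Rightarrow> nat" and u :: "'j \<Rightarrow> rat"
  assumes fin: "finite I" "finite J" and indep: "rows_indep (\<lambda>i j. of_nat (M i j)) I J"
    and u: "\<And>i. i \<in> I \<Longrightarrow> (\<Sum>j\<in>J. of_nat (M i j) * u j) = 0" and k: "k \<in> J" "u k \<noteq> 0"
    and n: "n \<ge> 1" and rows: "\<And>i. i \<in> I \<Longrightarrow> (\<Sum>j\<in>J. M i j) \<le> n"
  obtains z :: "'j \<Rightarrow> int" where "\<exists>j\<in>J. z j \<noteq> 0"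
    "\<And>j. \<bar>z j\<bar> \<le> int (n ^ (card I - card {i\<in>I. card {j\<in>J. M i j \<noteq> 0} = 1}))"
    "\<And>i. i \<in> I \<Longrightarrow> (\<Sum>j\<in>J. int (M i j) * z j) = 0"
proof -
  define U where "U = {i\<in>I. card {j\<in>J. M i j \<noteq> 0} = 1}"
  have U: "U \<subseteq> I" "finite U" using fin by (auto simp: U_def)
  have "\<exists>j. {j\<in>J. M i j \<noteq> 0} = {j}" if "i \<in> U" for i
    using that by (auto simp: U_def card_1_singleton_iff)
  then obtain s where s: "\<And>i. i \<in> U \<Longrightarrow> {j\<in>J. M i j \<noteq> 0} = {s i}" by metis
  have sJ: "s i \<in> J" "M i (s i) \<noteq> 0" if "i \<in> U" for i
  proof -
    have "s i \<in> {j\<in>J. M i j \<noteq> 0}" unfolding s[OF that] by simp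
    then show "s i \<in> J" "M i (s i) \<noteq> 0" by simp_all
  qed
  have s0: "M i j = 0" if "i \<in> U" "j \<in> J" "j \<noteq> s i" for i j
  proof (rule ccontr)
    assume "M i j \<noteq> 0"
    then have "j \<in> {j\<in>J. M i j \<noteq> 0}" using that by simp
    then show False unfolding s[OF that(1)] using that by simp
  qed
  have inj: "inj_on s U"
  proof (rule inj_onI, rule ccontr)
    fix i j assume ij: "i \<in> U" "j \<in> U" "s i = s j" "i \<noteq> j"
    \<comment> \<open>Two rows supported in the same single column are proportional; their entries,
      taken crosswise, are the coefficients of a relation.\<close>
    have "rat_of_nat (M j (s j)) = 0"
    proof (rule rows_indep_two_rows(1)[OF indep fin(1) _ _ ij(4), of _ "- rat_of_nat (M i (s i))"])
      fix l assume "l \<in> J"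
      show "rat_of_nat (M j (s j)) * rat_of_nat (M i l)
          + - rat_of_nat (M i (s i)) * rat_of_nat (M j l) = 0"
      proof (cases "l = s j")
        case True
        then show ?thesis unfolding ij(3) by simp
      next
        case False
        then have "M i l = 0" "M j l = 0" using ij \<open>l \<in> J\<close> s0[of i l] s0[of j l] by simp_all
        then show ?thesis by simp
      qed
    qed (use ij(1,2) U(1) in blast)+
    with sJ(2)[OF ij(2)] show False by simp
  qed
  have sub: "s ` U \<subseteq> J" using sJ by auto
  \<comment> \<open>Since \<open>s\<close> is injective, as many columns as rows are deleted, and
    the columns remain in the majority.\<close>
  have "card (I - U) < card (J - s ` U)"
    using rows_indep_card_less[OF fin indep u k] card_mono[OF fin(1) U(1)] U fin sub inj
    by (simp add: card_Diff_subset card_image)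
  moreover have "(\<Sum>j\<in>J - s ` U. M i j) \<le> n" if "i \<in> I - U" for i
    using rows[of i] that sum_mono2[of J "J - s ` U" "M i"] fin by fastforce
  ultimately have "\<exists>z :: 'j \<Rightarrow> int. (\<exists>j\<in>J - s ` U. z j \<noteq> 0) \<and>
      (\<forall>j. \<bar>z j\<bar> \<le> int (n ^ card (I - U))) \<and> (\<forall>i\<in>I - U. (\<Sum>j\<in>J - s ` U. int (M i j) * z j) = 0)"
    using fin n by (intro small_integer_kernel_vector) blast+
  then obtain z :: "'j \<Rightarrow> int" where z: "\<exists>j\<in>J - s ` U. z j \<noteq> 0"
      "\<And>j. \<bar>z j\<bar> \<le> int (n ^ card (I - U))"
      "\<And>i. i \<in> I - U \<Longrightarrow> (\<Sum>j\<in>J - s ` U. int (M i j) * z j) = 0"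
    by blast
  define z' where "z' = (\<lambda>j. if j \<in> J - s ` U then z j else 0)"
  show thesis
  proof (rule that[of z'])
    show "\<exists>j\<in>J. z' j \<noteq> 0" using z(1) unfolding z'_def by force
    show "\<bar>z' j\<bar> \<le> int (n ^ (card I - card {i\<in>I. card {j\<in>J. M i j \<noteq> 0} = 1}))" for j
      using z(2)[of j] U unfolding U_def[symmetric] z'_def by (auto simp: card_Diff_subset)
    fix i assume i: "i \<in> I"
    show "(\<Sum>j\<in>J. int (M i j) * z' j) = 0"
    proof (cases "i \<in> U")
      case True
      \<comment> \<open>In a deleted row the only nonzero entry sits in the deleted column
        \<open>s i\<close>, where \<open>z'\<close> is 0.\<close>
      then have "int (M i j) * z' j = 0" if "j \<in> J" for j
        using s0[OF True that] True by (cases "j = s i") (simp_all add: z'_def)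
      then show ?thesis by (intro sum.neutral) blast
    next
      case False
      have "(\<Sum>j\<in>J. int (M i j) * z' j) = (\<Sum>j\<in>J - s ` U. int (M i j) * z' j)"
        using fin by (intro sum.mono_neutral_right) (auto simp: z'_def)
      also have "\<dots> = (\<Sum>j\<in>J - s ` U. int (M i j) * z j)"
        by (intro sum.cong) (auto simp: z'_def)
      finally show ?thesis using z(3)[of i] i False by simp
    qed
  qed
qed

subsection \<open>Divisors of products of primes\<close>

text \<open>One copy of \<open>q\<close> divides \<open>A\<close> or its cofactor \<open>C\<close>.
  It is cancelled there and counts towards \<open>k\<close> in the first case only.\<close>

lemma dvd_prime_power_mult:
  fixes q :: "'a::idom"
  assumes q: "prime_elem q" and A: "A dvd q ^ n * Y"
  shows "\<exists>k\<le>n. \<exists>B. A = q ^ k * B \<and> B dvd Y"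
  using A
proof (induction n arbitrary: A)
  case (Suc n)
  then obtain C where C: "q * (q ^ n * Y) = A * C" by (auto simp: mult_ac dvd_def)
  then have "q dvd A * C" by (metis dvd_triv_left)
  then consider "q dvd A" | "q dvd C" using q prime_elem_dvd_mult_iff by blast
  then show ?case
  proof cases
    case 1
    then obtain A' where A': "A = q * A'" by blast
    then have "A' dvd q ^ n * Y" using C q by (auto simp: mult_ac dvd_def)
    then show ?thesis using Suc.IH[of A'] A' by (metis Suc_le_mono mult.assoc power_Suc)
  next
    case 2
    then have "A dvd q ^ n * Y" using C q by (auto simp: mult_ac dvd_def)
    then show ?thesis using Suc.IH[of A] le_SucI by blast
  qed
qed simp

text \<open>The prime powers are split off one at a time; what is left of \<open>A\<close> at the
  end divides 1 and becomes \<open>c\<close>.\<close>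

lemma dvd_prod_prime_powers:
  fixes q :: "'i \<Rightarrow> 'a::idom"
  assumes "finite I" "\<And>i. i \<in> I \<Longrightarrow> prime_elem (q i)" "A dvd (\<Prod>i\<in>I. q i ^ N i)"
  shows "\<exists>c a. c dvd 1 \<and> (\<forall>i\<in>I. a i \<le> N i) \<and> A = c * (\<Prod>i\<in>I. q i ^ a i)"
  using assms
proof (induction I arbitrary: A rule: finite_induct)
  case (insert i I)
  have "A dvd q i ^ N i * (\<Prod>i\<in>I. q i ^ N i)" using insert.hyps insert.prems by simp
  with insert.prems(1) obtain k B
    where B: "k \<le> N i" "A = q i ^ k * B" "B dvd (\<Prod>i\<in>I. q i ^ N i)"
    by (meson dvd_prime_power_mult insertI1)
  have "\<exists>c a. c dvd 1 \<and> (\<forall>i\<in>I. a i \<le> N i) \<and> B = c * (\<Prod>i\<in>I. q i ^ a i)"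
    by (rule insert.IH) (use insert.prems(1) B(3) in auto)
  then obtain c a
    where ca: "c dvd 1" "\<forall>i\<in>I. a i \<le> N i" "B = c * (\<Prod>i\<in>I. q i ^ a i)" by blast
  have "(\<Prod>j\<in>I. q j ^ (a(i := k)) j) = (\<Prod>i\<in>I. q i ^ a i)"
    using insert.hyps by (intro prod.cong) auto
  then show ?case using insert.hyps ca B
    by (intro exI[of _ c] exI[of _ "a(i := k)"]) (auto simp: mult_ac)
qed auto

lemma prime_elem_dvd_prodD:
  assumes "finite I" "prime_elem q" "q dvd (\<Prod>i\<in>I. h i)"
  shows "\<exists>i\<in>I. q dvd h i"
  using assms
proof (induction I rule: finite_induct)
  case empty
  then show ?case by (simp add: prime_elem_def)
next
  case (insert i I)
  then show ?case by (auto simp: prime_elem_dvd_mult_iff)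
qed

subsection \<open>Discrete valuation domains and Gauss's lemma\<close>

lemma common_denominator:
  fixes A :: "'a::idom fract poly"
  shows "\<exists>d h. d \<noteq> 0 \<and> smult (to_fract d) A = map_poly to_fract h"
proof (induction A)
  case 0
  show ?case by (intro exI[of _ 1] exI[of _ 0]) simp
next
  case (pCons c A)
  then obtain d h where d: "d \<noteq> 0" "smult (to_fract d) A = map_poly to_fract h" by blast
  obtain a b where ab: "c = Fract a b" "b \<noteq> 0" by (cases c)
  then have "to_fract b * c = to_fract a" by (simp add: Fract_conv_to_fract)
  then have "smult (to_fract (b * d)) (pCons c A) = map_poly to_fract (pCons (d * a) (smult b h))"
    by (simp add: map_poly_pCons mult_ac flip: d(2))
  then show ?case using d(1) ab(2) by (intro exI[of _ "b * d"] exI) auto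
qed

section \<open>The valuation of a discrete valuation domain\<close>

locale discrete_valuation =
  fixes p :: "'a::idom"
  assumes dvr: "dvr p"
begin

lemma p_nonzero [simp]: "p \<noteq> 0" and p_not_unit: "\<not> p dvd 1"
  using dvr by (auto simp: dvr_def)

lemma unit_times_power: "a \<noteq> 0 \<Longrightarrow> \<exists>e k. e dvd 1 \<and> a = e * p ^ k"
  using dvr by (auto simp: dvr_def)

text \<open>For nonzero \<open>a\<close> this identifies the set \<open>{k. p ^ k dvd a}\<close> in
  \<open>pmult\<close> as an initial segment, so its maximum exists and is the exponent of
  \<open>p\<close> in \<open>a\<close>.\<close>

lemma power_dvd_unit_times_power:
  assumes "e dvd 1"
  shows "p ^ j dvd e * p ^ k \<longleftrightarrow> j \<le> k"
proof
  assume *: "p ^ j dvd e * p ^ k"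
  show "j \<le> k"
  proof (rule ccontr)
    assume "\<not> j \<le> k"
    then have j: "j = Suc (j - Suc k) + k" by simp
    from * have "p ^ Suc (j - Suc k) * p ^ k dvd e * p ^ k"
      by (subst (asm) j) (simp only: power_add)
    then have "p ^ Suc (j - Suc k) dvd e" by (subst (asm) dvd_mult_cancel_right) simp
    then have "p dvd e" by (metis dvd_mult_left power_Suc)
    with assms p_not_unit dvd_trans show False by blast
  qed
qed (simp add: le_imp_power_dvd)

lemma pmult_unit_times_power: "e dvd 1 \<Longrightarrow> pmult p (e * p ^ k) = k"
  unfolding pmult_def power_dvd_unit_times_power by (intro Max_eqI) auto

lemma pmult_decomp:
  assumes "a \<noteq> 0"
  obtains e where "e dvd 1" "a = e * p ^ pmult p a"
  using unit_times_power[OF assms] pmult_unit_times_power by metis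

lemma power_dvd_iff: "a \<noteq> 0 \<Longrightarrow> p ^ j dvd a \<longleftrightarrow> j \<le> pmult p a"
  using pmult_decomp[of a] power_dvd_unit_times_power by metis

lemma pmult_mult:
  assumes "a \<noteq> 0" "b \<noteq> 0"
  shows "pmult p (a * b) = pmult p a + pmult p b"
proof -
  obtain e where e: "e dvd 1" "a = e * p ^ pmult p a" using pmult_decomp[OF assms(1)] .
  obtain e' where e': "e' dvd 1" "b = e' * p ^ pmult p b" using pmult_decomp[OF assms(2)] .
  have "a * b = (e * e') * p ^ (pmult p a + pmult p b)"
    by (subst e(2), subst e'(2)) (simp add: power_add mult_ac)
  moreover have "e * e' dvd 1" using mult_dvd_mono[OF e(1) e'(1)] by simp
  ultimately show ?thesis using pmult_unit_times_power by metis
qed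

lemma pmult_one [simp]: "pmult p 1 = 0"
  using pmult_unit_times_power[of 1 0] by simp

lemma pmult_power: "a \<noteq> 0 \<Longrightarrow> pmult p (a ^ k) = k * pmult p a"
  by (induction k) (simp_all add: pmult_mult)

lemma pmult_prod: "(\<And>i. i \<in> I \<Longrightarrow> h i \<noteq> 0) \<Longrightarrow> pmult p (\<Prod>i\<in>I. h i) = (\<Sum>i\<in>I. pmult p (h i))"
  by (induction I rule: infinite_finite_induct) (simp_all add: pmult_mult)

lemma power_dvd_power:
  assumes "p ^ (k * j) dvd a ^ k" "k \<ge> 1"
  shows "p ^ j dvd a"
  using assms by (cases "a = 0") (auto simp: power_dvd_iff pmult_power)

lemma prime_elem_p: "prime_elem p"
proof (rule prime_elemI)
  fix a b assume *: "p dvd a * b"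
  show "p dvd a \<or> p dvd b"
  proof (cases "a = 0 \<or> b = 0")
    case False
    with * power_dvd_iff[of _ 1] show ?thesis by (auto simp: pmult_mult)
  qed auto
qed (use p_not_unit in auto)

section \<open>Gauss's lemma and irreducibility over the quotient field\<close>

text \<open>This is Gauss's lemma: over a local ring with maximal ideal \<open>pR\<close>, a
  polynomial is primitive iff \<open>[:p:]\<close> does not divide it, and primality of
  \<open>[:p:]\<close> says that primitive polynomials are closed under products.\<close>

lemma prime_elem_const_p: "prime_elem [:p:]"
  using prime_elem_p by (rule lift_prime_elem_poly)

lemma const_p_dvd_smult_unit:
  assumes "e dvd 1"
  shows "[:p:] dvd smult e g \<longleftrightarrow> [:p:] dvd g"
proof -
  obtain e' where "1 = e * e'" using assms by blast
  then have "g = smult e' (smult e g)" by (simp add: mult.commute)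
  then show ?thesis by (metis dvd_smult)
qed

text \<open>Write \<open>a\<close> and \<open>b\<close> as units times \<open>p ^ i\<close> and
  \<open>p ^ j\<close>. If \<open>i\<close> and \<open>j\<close> differed, cancelling the smaller
  power would leave a factor \<open>p\<close> in \<open>g\<close> or in \<open>h\<close>. So the
  powers cancel completely and only units remain.\<close>

lemma smult_eq_smult_imp_associated:
  assumes eq: "smult a g = smult b h" and ab: "a \<noteq> 0" "b \<noteq> 0"
    and g: "\<not> [:p:] dvd g" and h: "\<not> [:p:] dvd h"
  shows "\<exists>e. e dvd 1 \<and> g = smult e h"
proof -
  obtain c where c: "c dvd 1" "a = c * p ^ pmult p a" using pmult_decomp[OF ab(1)] .
  obtain d where d: "d dvd 1" "b = d * p ^ pmult p b" using pmult_decomp[OF ab(2)] .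
  define i j where "i = pmult p a" and "j = pmult p b"
  have *: "smult (p ^ i * c) g = smult (p ^ j * d) h"
    using eq by (subst (asm) c(2), subst (asm) d(2)) (simp add: i_def j_def mult_ac)
  have dvd: "[:p:] dvd smult (p ^ k) q" if "k > 0" for k and q :: "'a poly"
    using that by (cases k) (auto simp: const_poly_dvd_iff)
  have cancel: "q = r" if "smult (p ^ k) q = smult (p ^ k) r" for k and q r :: "'a poly"
    using that by (simp add: poly_eq_iff)
  have "i = j"
  proof (rule ccontr)
    assume "i \<noteq> j"
    then consider "i < j" | "j < i" by linarith
    then show False
    proof cases
      case 1
      then have pj: "p ^ j = p ^ i * p ^ (j - i)" by (simp flip: power_add)
      have "smult c g = smult (p ^ (j - i)) (smult d h)"
        by (rule cancel[of i]) (simp add: * pj mult.assoc[symmetric])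
      then have "[:p:] dvd smult c g" using dvd[of "j - i" "smult d h"] 1 by (simp only: zero_less_diff)
      with g c(1) show False by (simp add: const_p_dvd_smult_unit)
    next
      case 2
      then have pi: "p ^ i = p ^ j * p ^ (i - j)" by (simp flip: power_add)
      have "smult d h = smult (p ^ (i - j)) (smult c g)"
        by (rule cancel[of j]) (simp add: *[symmetric] pi mult.assoc[symmetric])
      then have "[:p:] dvd smult d h" using dvd[of "i - j" "smult c g"] 2 by (simp only: zero_less_diff)
      with h d(1) show False by (simp add: const_p_dvd_smult_unit)
    qed
  qed
  with * have eq': "smult c g = smult d h" by (intro cancel[of i "smult c g" "smult d h"]) simp
  obtain c' where c': "1 = c * c'" using c(1) by blast
  then have "g = smult c' (smult c g)" by (simp add: mult.commute)
  also have "\<dots> = smult (c' * d) h" by (simp add: eq')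
  finally have "g = smult (c' * d) h" .
  moreover have "c' * d dvd 1" using c' d(1) mult_dvd_mono[of c' 1 d 1] by (metis dvd_triv_right mult_1)
  ultimately show ?thesis by blast
qed

lemma fract_smult_imp_associated:
  assumes eq: "map_poly to_fract g = smult c (map_poly to_fract h)" and c: "c \<noteq> 0"
    and g: "\<not> [:p:] dvd g" and h: "\<not> [:p:] dvd h"
  shows "\<exists>e. e dvd 1 \<and> g = smult e h"
proof -
  obtain a b where ab: "c = Fract a b" "b \<noteq> 0" by (cases c)
  then have c': "c * to_fract b = to_fract a" by (simp add: Fract_conv_to_fract)
  have "map_poly to_fract (smult b g) = map_poly to_fract (smult a h)"
    by (simp add: eq flip: c' add: mult.commute)
  then have "smult b g = smult a h" by (simp only: fract_poly_eq_iff)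
  moreover have "a \<noteq> 0" using c ab by (metis Fract_conv_to_fract divide_eq_0_iff to_fract_0)
  ultimately show ?thesis using smult_eq_smult_imp_associated g h ab(2) by blast
qed

text \<open>Each division by \<open>p\<close> lowers the valuation of the leading coefficient, so
  the process stops.\<close>

lemma primitive_part_exists:
  assumes "h \<noteq> 0"
  shows "\<exists>j h0. h = smult (p ^ j) h0 \<and> \<not> [:p:] dvd h0"
  using assms
proof (induction "pmult p (lead_coeff h)" arbitrary: h rule: less_induct)
  case less
  show ?case
  proof (cases "[:p:] dvd h")
    case True
    then obtain h' where h': "h = smult p h'" by auto
    then have "h' \<noteq> 0" using less.prems by auto
    then have "pmult p (lead_coeff h') < pmult p (lead_coeff h)"
      using power_dvd_iff[of p 1] by (simp add: h' pmult_mult)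
    from less.hyps[OF this \<open>h' \<noteq> 0\<close>] obtain j h0 where "h' = smult (p ^ j) h0" "\<not> [:p:] dvd h0"
      by blast
    then show ?thesis using h' by (intro exI[of _ "Suc j"] exI[of _ h0]) simp
  qed (auto intro!: exI[of _ 0] exI[of _ h])
qed

lemma fract_primitive_part_exists:
  fixes A :: "'a fract poly"
  assumes "A \<noteq> 0"
  shows "\<exists>c h. c \<noteq> 0 \<and> A = smult c (map_poly to_fract h) \<and> \<not> [:p:] dvd h"
proof -
  obtain d h where d: "d \<noteq> 0" "smult (to_fract d) A = map_poly to_fract h"
    using common_denominator[of A] by blast
  then have "h \<noteq> 0" using assms by auto
  then obtain j h0 where h: "h = smult (p ^ j) h0" "\<not> [:p:] dvd h0"
    using primitive_part_exists by blast
  have "A = smult (inverse (to_fract d)) (smult (to_fract d) A)" using d(1) by simp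
  also have "\<dots> = smult (inverse (to_fract d) * to_fract (p ^ j)) (map_poly to_fract h0)"
    by (simp add: d(2) h(1))
  finally show ?thesis using d(1) h(2) by (intro exI conjI) auto
qed

lemma irreducible_not_dvd:
  assumes "irreducible g" "degree g > 0"
  shows "\<not> [:p:] dvd g"
proof
  assume "[:p:] dvd g"
  then obtain h where h: "g = [:p:] * h" by blast
  from irreducibleD[OF assms(1) h] have "h dvd 1"
    using prime_elem_const_p by (auto simp: prime_elem_def)
  then show False using h assms(2) by (auto simp: is_unit_poly_iff)
qed

text \<open>A factorization over the quotient field is rewritten with primitive parts
  \<open>h\<close> and \<open>k\<close>. Then \<open>h * k\<close> is primitive, so the constant in
  front is a unit of \<open>R\<close>, and irreducibility of \<open>g\<close> in \<open>R[x]\<close>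
  makes one of the factors constant.\<close>

lemma prime_elem_fract_poly:
  fixes g :: "'a poly"
  assumes g: "irreducible g" "degree g > 0"
  shows "prime_elem (map_poly to_fract g)"
proof (rule field_poly_irreducible_imp_prime, rule irreducibleI)
  have g0: "g \<noteq> 0" using g by auto
  then show "map_poly to_fract g \<noteq> 0" by simp
  then show "\<not> map_poly to_fract g dvd 1"
    using g(2) by (auto simp: is_unit_iff_degree degree_map_poly)
  fix A B assume AB: "map_poly to_fract g = A * B"
  then have "A \<noteq> 0" "B \<noteq> 0" using g0 by auto
  obtain c h where h: "c \<noteq> 0" "A = smult c (map_poly to_fract h)" "\<not> [:p:] dvd h"
    using fract_primitive_part_exists[OF \<open>A \<noteq> 0\<close>] by blast
  obtain d k where k: "d \<noteq> 0" "B = smult d (map_poly to_fract k)" "\<not> [:p:] dvd k"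
    using fract_primitive_part_exists[OF \<open>B \<noteq> 0\<close>] by blast
  have "map_poly to_fract g = smult (c * d) (map_poly to_fract (h * k))"
    using AB h k by (simp add: mult_ac)
  moreover have "\<not> [:p:] dvd h * k"
    using prime_elem_dvd_mult_iff[OF prime_elem_const_p] h k by blast
  ultimately obtain e where e: "e dvd 1" "g = smult e h * k"
    using fract_smult_imp_associated[of g "c * d" "h * k"] irreducible_not_dvd[OF g] h(1) k(1) by auto
  from irreducibleD[OF g(1) e(2)] have "degree (smult e h) = 0 \<or> degree k = 0"
    by (metis degree_pCons_0 is_unit_poly_iff)
  moreover have "e \<noteq> 0" using e(1) by auto
  ultimately have "degree A = 0 \<or> degree B = 0"
    using h k by (simp add: degree_map_poly)
  then show "A dvd 1 \<or> B dvd 1" using \<open>A \<noteq> 0\<close> \<open>B \<noteq> 0\<close> by (simp add: is_unit_iff_degree)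
qed

text \<open>Passing to the quotient field creates no new divisibility between irreducible
  polynomials; hence distinct elements of \<open>P\<close> stay distinct primes there.\<close>

lemma fract_poly_dvd_imp_associated:
  fixes g h :: "'a poly"
  assumes "irreducible g" "degree g > 0" "irreducible h" "degree h > 0"
    and "map_poly to_fract g dvd map_poly to_fract h"
  shows "\<exists>e. e dvd 1 \<and> h = smult e g"
proof -
  obtain C where C: "map_poly to_fract h = map_poly to_fract g * C" using assms(5) by blast
  have "irreducible (map_poly to_fract h)"
    using prime_elem_fract_poly[OF assms(3,4)] prime_elem_imp_irreducible by blast
  from irreducibleD[OF this C] have "C dvd 1"
    using prime_elem_fract_poly[OF assms(1,2)] by (auto simp: prime_elem_def)
  then obtain c where c: "C = [:c:]" "c dvd 1" by (auto simp: is_unit_poly_iff)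
  then have "map_poly to_fract h = smult c (map_poly to_fract g)" "c \<noteq> 0" using C by auto
  then show ?thesis
    by (rule fract_smult_imp_associated) (use irreducible_not_dvd assms(1-4) in blast)+
qed

end

subsection \<open>Integer-valued polynomials and unique factorization\<close>

definition fract_quot :: "'a::idom \<Rightarrow> nat \<Rightarrow> 'a poly \<Rightarrow> 'a fract poly" where
  "fract_quot p e h = smult (inverse (to_fract (p ^ e))) (map_poly to_fract h)"

lemma to_fract_power [simp]: "to_fract (a ^ k) = to_fract a ^ k"
  by (induction k) simp_all

lemma fract_poly_power [simp]: "map_poly to_fract (h ^ k) = map_poly to_fract h ^ k"
  by (induction k) simp_all

lemma fract_poly_prod [simp]: "map_poly to_fract (\<Prod>i\<in>I. h i) = (\<Prod>i\<in>I. map_poly to_fract (h i))"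
  by (induction I rule: infinite_finite_induct) simp_all

lemma poly_fract_poly [simp]: "poly (map_poly to_fract h) (to_fract x) = to_fract (poly h x)"
  by (induction h) (simp_all add: map_poly_pCons)

lemma fract_quot_mult: "fract_quot p e h * fract_quot p e' h' = fract_quot p (e + e') (h * h')"
  by (simp add: fract_quot_def power_add mult_ac)

lemma fract_quot_power: "fract_quot p e h ^ k = fract_quot p (k * e) (h ^ k)"
  by (simp add: fract_quot_def smult_power power_inverse power_mult[symmetric] mult.commute)

lemma degree_fract_quot: "p \<noteq> 0 \<Longrightarrow> degree (fract_quot p e h) = degree h"
  by (simp add: fract_quot_def degree_map_poly)

lemma poly_fract_quot: "poly (fract_quot p e h) (to_fract x) = to_fract (poly h x) / to_fract (p ^ e)"
  by (simp add: fract_quot_def field_simps)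

lemma fract_quot_in_IntR_iff:
  assumes "p \<noteq> 0"
  shows "fract_quot p e h \<in> IntR \<longleftrightarrow> (\<forall>x. p ^ e dvd poly h x)"
proof -
  have "to_fract (poly h x) / to_fract (p ^ e) \<in> range to_fract \<longleftrightarrow> p ^ e dvd poly h x" for x
  proof -
    have "to_fract (poly h x) / to_fract (p ^ e) = to_fract y \<longleftrightarrow> poly h x = p ^ e * y" for y
      using assms by (subst to_fract_eq_iff[symmetric]) (auto simp: field_simps simp del: to_fract_eq_iff)
    then show ?thesis by (auto simp: dvd_def)
  qed
  then show ?thesis by (simp only: IntR_def mem_Collect_eq poly_fract_quot)
qed

lemma IntR_mult: "A \<in> IntR \<Longrightarrow> B \<in> IntR \<Longrightarrow> A * B \<in> IntR"
  unfolding IntR_def by (simp add: image_iff) (metis to_fract_mult)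

lemma IntR_one: "1 \<in> IntR"
  unfolding IntR_def by (auto intro: range_eqI[of _ _ 1])

lemma IntR_prod_list: "set xs \<subseteq> IntR \<Longrightarrow> prod_list xs \<in> IntR"
  by (induction xs) (auto intro: IntR_mult IntR_one)

section \<open>Units and associates in Int(R)\<close>

lemma unit_in_mult: "unit_in IntR A \<Longrightarrow> unit_in IntR B \<Longrightarrow> unit_in IntR (A * B)"
proof -
  assume "unit_in IntR A" "unit_in IntR B"
  then obtain C D where CD: "A \<in> IntR" "B \<in> IntR" "C \<in> IntR" "D \<in> IntR" "A * C = 1" "B * D = 1"
    by (auto simp: unit_in_def)
  then have "(A * B) * (C * D) = 1" by (metis mult.assoc mult.left_commute mult_1)
  then show ?thesis using CD IntR_mult unfolding unit_in_def by blast
qed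

lemma unit_in_inverse: "unit_in IntR A \<Longrightarrow> \<exists>B. unit_in IntR B \<and> A * B = 1"
  unfolding unit_in_def by (metis mult.commute)

lemma unit_in_const:
  assumes "e dvd (1::'a::idom)"
  shows "unit_in IntR [:to_fract e:]"
proof -
  obtain e' where "1 = e * e'" using assms by blast
  then have "to_fract e * to_fract e' = 1" by (metis to_fract_1 to_fract_mult)
  then have "[:to_fract e:] * [:to_fract e':] = 1" by (simp add: one_pCons mult.commute)
  moreover have "[:to_fract c:] \<in> IntR" for c :: 'a by (simp add: IntR_def)
  ultimately show ?thesis unfolding unit_in_def by blast
qed

lemma degree_unit_in: "unit_in IntR A \<Longrightarrow> degree A = 0"
  unfolding unit_in_def by (metis dvdI is_unit_iff_degree mult_zero_left zero_neq_one)

lemma assoc_in_trans_sym: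
  assumes "assoc_in IntR A C" "assoc_in IntR B C"
  shows "assoc_in IntR A B"
proof -
  obtain D E where DE: "unit_in IntR D" "A = D * C" "unit_in IntR E" "B = E * C"
    using assms by (auto simp: assoc_in_def)
  obtain E' where E': "unit_in IntR E'" "E * E' = 1" using unit_in_inverse[OF DE(3)] by blast
  have "A = (D * E') * B" using DE E' by (metis mult.assoc mult.commute mult_1)
  then show ?thesis using unit_in_mult[OF DE(1) E'(1)] unfolding assoc_in_def by blast
qed

lemma assoc_in_imp_smult:
  assumes "assoc_in IntR A B"
  shows "\<exists>c. c \<noteq> 0 \<and> A = smult c B"
proof -
  obtain E where E: "unit_in IntR E" "A = E * B" using assms by (auto simp: assoc_in_def)
  moreover have "E \<noteq> 0" using E(1) by (auto simp: unit_in_def)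
  moreover obtain c where "E = [:c:]" using degree_unit_in[OF E(1)] degree_eq_zeroE by blast
  ultimately show ?thesis by auto
qed

lemma prod_list_assoc:
  assumes "\<forall>A\<in>set xs. assoc_in IntR A B"
  shows "\<exists>c. c \<noteq> 0 \<and> prod_list xs = smult c (B ^ length xs)"
  using assms
proof (induction xs)
  case Nil
  show ?case by (intro exI[of _ 1]) simp
next
  case (Cons A xs)
  then obtain c where c: "c \<noteq> 0" "prod_list xs = smult c (B ^ length xs)" by auto
  obtain d where d: "d \<noteq> 0" "A = smult d B" using assoc_in_imp_smult[of A B] Cons.prems by auto
  show ?case using c d by (intro exI[of _ "c * d"]) (simp add: mult_ac)
qed

text \<open>One direction compares with the factorization \<open>F * ... * F\<close>. For the other,
  units of Int(R) are constants, so comparing degrees forces every factorization to have length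
  \<open>k\<close>; any bijection then matches the factors, and the identity is taken.\<close>

lemma factors_uniquely_iff_assoc:
  assumes F: "irred_in IntR F" "degree F > 0"
  shows "factors_uniquely_in IntR (F ^ k) \<longleftrightarrow>
    (\<forall>xs. factorization_in IntR (F ^ k) xs \<longrightarrow> (\<forall>A\<in>set xs. assoc_in IntR A F))"
proof
  assume unique: "factors_uniquely_in IntR (F ^ k)"
  show "\<forall>xs. factorization_in IntR (F ^ k) xs \<longrightarrow> (\<forall>A\<in>set xs. assoc_in IntR A F)"
  proof (intro allI impI ballI)
    fix xs A assume xs: "factorization_in IntR (F ^ k) xs" and A: "A \<in> set xs"
    have F': "factorization_in IntR (F ^ k) (replicate k F)"
      using F by (auto simp: factorization_in_def prod_list_replicate)
    obtain \<sigma> where \<sigma>: "bij_betw \<sigma> {..<length xs} {..<length (replicate k F)}"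
        "\<forall>i<length xs. assoc_in IntR (xs ! i) (replicate k F ! \<sigma> i)"
      using unique[unfolded factors_uniquely_in_def, rule_format, OF conjI, OF xs F'] by blast
    obtain i where i: "i < length xs" "A = xs ! i" using A by (metis in_set_conv_nth)
    have "\<sigma> i < k" using bij_betwE[OF \<sigma>(1)] i by auto
    with \<sigma>(2) i show "assoc_in IntR A F" by auto
  qed
next
  assume *: "\<forall>xs. factorization_in IntR (F ^ k) xs \<longrightarrow> (\<forall>A\<in>set xs. assoc_in IntR A F)"
  have length: "length xs = k" if xs: "factorization_in IntR (F ^ k) xs" for xs
  proof -
    obtain c where c: "c \<noteq> 0" "prod_list xs = smult c (F ^ length xs)"
      using prod_list_assoc[of xs F] * xs by blast
    then have "F ^ k = smult c (F ^ length xs)" using xs by (simp add: factorization_in_def)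
    then have "degree (F ^ k) = degree (F ^ length xs)" using c(1) by simp
    moreover have "F \<noteq> 0" using F by auto
    ultimately show ?thesis using F(2) by (simp add: degree_power_eq)
  qed
  show "factors_uniquely_in IntR (F ^ k)"
    unfolding factors_uniquely_in_def
  proof (intro allI impI conjI)
    fix xs ys
    assume xy: "factorization_in IntR (F ^ k) xs \<and> factorization_in IntR (F ^ k) ys"
    then show len: "length xs = length ys" using length[of xs] length[of ys] by simp
    have "assoc_in IntR (xs ! i) (ys ! i)" if "i < length xs" for i
    proof (rule assoc_in_trans_sym[of _ F])
      show "assoc_in IntR (xs ! i) F" using * xy nth_mem[OF that] by blast
      have "ys ! i \<in> set ys" using that len by simp
      then show "assoc_in IntR (ys ! i) F" using * xy by blast
    qed
    then show "\<exists>\<sigma>. bij_betw \<sigma> {..<length xs} {..<length ys} \<and>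
        (\<forall>i<length xs. assoc_in IntR (xs ! i) (ys ! \<sigma> i))"
      by (intro exI[of _ id]) (simp add: len)
  qed
qed

lemma vd_le_vval: "vd p f \<le> vval p (poly f a)"
  unfolding vd_def by (rule INF_lower) simp

text \<open>The infimum defining \<open>vd\<close> is attained because \<open>enat\<close> is
  well-ordered.\<close>

lemma Wset_nonempty: "Wset p f \<noteq> {}"
proof -
  have "vd p f \<in> range (\<lambda>a. vval p (poly f a))"
    unfolding vd_def by (rule wellorder_InfI[OF rangeI])
  then show ?thesis by (auto simp: Wset_def)
qed

lemma diff_dvd_poly_diff: "x - y dvd poly h x - poly h (y :: 'a::comm_ring_1)"
proof (induction h)
  case (pCons c h)
  have "poly (pCons c h) x - poly (pCons c h) y = (x - y) * poly h x + y * (poly h x - poly h y)"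
    by (simp add: algebra_simps)
  then show ?case using pCons.IH by simp
qed simp

subsection \<open>Divisors of powers of \<open>F\<close>\<close>

locale int_valued_quotient = discrete_valuation p for p :: "'a::idom" +
  fixes f :: "'a poly" and P :: "'a poly set" and m :: "'a poly \<Rightarrow> nat" and n :: nat
  assumes degree_f: "degree f > 0" and primitive_f: "primitive f"
    and divisors: "irr_divisor_set f P"
    and m: "\<And>g. g \<in> P \<Longrightarrow> m g \<ge> 1" and f: "f = (\<Prod>g\<in>P. g ^ m g)"
    and vd_f: "vd p f = enat n" and n: "n \<ge> 1"
begin

abbreviation v :: "'a poly \<Rightarrow> 'a \<Rightarrow> nat" where
  "v g x \<equiv> pmult p (poly g x)"

abbreviation F :: "'a fract poly" where
  "F \<equiv> fract_quot p n f"

section \<open>Products of powers of the irreducible divisors of f\<close>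

definition monomial :: "('a poly \<Rightarrow> nat) \<Rightarrow> 'a poly" where
  "monomial a = (\<Prod>g\<in>P. g ^ a g)"

lemma finite_P: "finite P"
proof (rule ccontr)
  assume "infinite P"
  \<comment> \<open>A product over an infinite set is 1 by convention.\<close>
  then have "f = 1" by (simp add: f)
  with degree_f show False by simp
qed

lemma irreducible_P: "g \<in> P \<Longrightarrow> irreducible g"
  using divisors by (simp add: irr_divisor_set_def)

text \<open>A constant divisor of \<open>f\<close> divides every coefficient, hence 1 by
  primitivity, and so cannot be irreducible.\<close>

lemma degree_P:
  assumes g: "g \<in> P"
  shows "degree g > 0"
proof (rule ccontr)
  assume "\<not> degree g > 0"
  then obtain c where c: "g = [:c:]" by (metis degree_eq_zeroE gr0I)
  have "g dvd f" using divisors g by (simp add: irr_divisor_set_def)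
  then have "c dvd coeff f i" for i by (auto simp: c const_poly_dvd_iff)
  moreover obtain b where "(\<Sum>i\<le>degree f. b i * coeff f i) = 1"
    using primitive_f by (auto simp: primitive_def)
  ultimately have "c dvd 1" using dvd_sum[of "{..degree f}" c "\<lambda>i. b i * coeff f i"] by simp
  then have "g dvd 1" by (auto simp: c is_unit_poly_iff)
  with irreducible_P[OF g] show False by (simp add: irreducible_def)
qed

lemma P_nonempty: "P \<noteq> {}"
  using degree_f f by auto

lemma associated_in_P:
  assumes "g \<in> P" "h \<in> P" "e dvd 1" "h = smult e g"
  shows "g = h"
proof -
  obtain e' where "1 = e * e'" using assms(3) by blast
  then have "g = smult e' h" by (simp add: assms(4) mult.commute)
  then have "h dvd g" by (metis dvd_refl dvd_smult)
  moreover have "g dvd h" unfolding assms(4) by (intro dvd_smult dvd_refl)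
  moreover have "\<exists>!k. k \<in> P \<and> g dvd k \<and> k dvd g"
    using divisors assms(1) by (auto simp: irr_divisor_set_def)
  ultimately show ?thesis using assms(1,2) dvd_refl[of g] by blast
qed

lemma fract_dvd_in_P:
  assumes "g \<in> P" "h \<in> P" "map_poly to_fract g dvd map_poly to_fract h"
  shows "g = h"
proof -
  obtain e where "e dvd 1" "h = smult e g"
    using fract_poly_dvd_imp_associated[OF irreducible_P[OF assms(1)] degree_P[OF assms(1)]
        irreducible_P[OF assms(2)] degree_P[OF assms(2)] assms(3)] by auto
  then show ?thesis by (rule associated_in_P[OF assms(1,2)])
qed

lemma prime_elem_P: "g \<in> P \<Longrightarrow> prime_elem (map_poly to_fract g)"
  using prime_elem_fract_poly irreducible_P degree_P by blast

lemma monomial_m: "monomial m = f"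
  by (simp add: monomial_def f)

lemma monomial_add: "monomial (\<lambda>g. a g + b g) = monomial a * monomial b"
  by (simp add: monomial_def power_add prod.distrib)

lemma monomial_mult: "monomial (\<lambda>g. k * a g) = monomial a ^ k"
  by (simp add: monomial_def prod_power_distrib power_mult[symmetric] mult.commute)

lemma monomial_cong: "(\<And>g. g \<in> P \<Longrightarrow> a g = b g) \<Longrightarrow> monomial a = monomial b"
  by (simp add: monomial_def)

lemma degree_monomial: "degree (monomial a) = (\<Sum>g\<in>P. a g * degree g)"
proof -
  have "g \<noteq> 0" if "g \<in> P" for g using degree_P[OF that] by auto
  then show ?thesis unfolding monomial_def by (subst degree_prod_eq_sum_degree) (auto simp: degree_power_eq)
qed

lemma degree_monomial_eq_0: "degree (monomial a) = 0 \<longleftrightarrow> (\<forall>g\<in>P. a g = 0)"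
  using degree_P finite_P by (fastforce simp: degree_monomial)

lemma poly_monomial: "poly (monomial a) x = (\<Prod>g\<in>P. poly g x ^ a g)"
  by (simp add: monomial_def poly_prod)

lemma poly_nonzero_P: "poly f x \<noteq> 0 \<Longrightarrow> g \<in> P \<Longrightarrow> poly g x \<noteq> 0"
  using finite_P m[of g] by (subst (asm) f) (auto simp: poly_prod)

lemma poly_monomial_nonzero: "poly f x \<noteq> 0 \<Longrightarrow> poly (monomial a) x \<noteq> 0"
  using poly_nonzero_P finite_P by (simp add: poly_monomial)

lemma pmult_monomial:
  assumes "poly f x \<noteq> 0"
  shows "v (monomial a) x = (\<Sum>g\<in>P. a g * v g x)"
  using poly_nonzero_P[OF assms] by (simp add: poly_monomial pmult_prod pmult_power)

lemma pmult_f: "poly f x \<noteq> 0 \<Longrightarrow> v f x = (\<Sum>g\<in>P. m g * v g x)"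
  using pmult_monomial[of x m] by (simp add: monomial_m)

lemma pmult_f_ge: "poly f x \<noteq> 0 \<Longrightarrow> n \<le> v f x"
  using vd_le_vval[of p f x] by (simp add: vd_f vval_def)

lemma Wset_iff: "w \<in> Wset p f \<longleftrightarrow> poly f w \<noteq> 0 \<and> v f w = n"
  by (simp add: Wset_def vd_f vval_def)

text \<open>Unique factorization over the quotient field, done for one prime \<open>g\<close>: after
  cancelling the smaller power of \<open>g\<close>, a surplus factor \<open>g\<close> would divide a
  product of powers of the other elements of \<open>P\<close>.\<close>

lemma monomial_inj:
  assumes eq: "smult c (map_poly to_fract (monomial a)) = smult d (map_poly to_fract (monomial b))"
    and cd: "c \<noteq> 0" "d \<noteq> 0" and g: "g \<in> P"
  shows "a g = b g"
proof -
  have le: "b g \<le> a g"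
    if eq: "smult c (map_poly to_fract (monomial a)) = smult d (map_poly to_fract (monomial b))"
      and cd: "c \<noteq> 0" "d \<noteq> 0" for a b c d
  proof (rule ccontr)
    let ?g = "map_poly to_fract g"
    let ?r = "\<lambda>a. \<Prod>h\<in>P - {g}. map_poly to_fract h ^ a h"
    assume "\<not> b g \<le> a g"
    \<comment> \<open>The outer \<open>Suc\<close> displays one surplus factor
      \<open>g\<close>.\<close>
    then have "b g = a g + Suc (b g - Suc (a g))" by simp
    then have b: "?g ^ b g = ?g ^ a g * ?g ^ Suc (b g - Suc (a g))" by (metis power_add)
    have split: "map_poly to_fract (monomial a) = ?g ^ a g * ?r a" for a
      using finite_P g by (simp add: monomial_def prod.remove)
    have "?g ^ a g * smult c (?r a) = ?g ^ a g * (?g * smult d (?g ^ (b g - Suc (a g)) * ?r b))"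
      using eq by (simp only: split b mult_smult_right mult.assoc power_Suc)
    moreover have "?g ^ a g \<noteq> 0" using prime_elem_P[OF g] by auto
    ultimately have "smult c (?r a) = ?g * smult d (?g ^ (b g - Suc (a g)) * ?r b)"
      using mult_left_cancel by blast
    then have "?g dvd smult c (?r a)" by (rule dvdI)
    then have "?g dvd ?r a" using cd(1) by (simp add: dvd_smult_iff)
    then obtain h where h: "h \<in> P - {g}" "?g dvd map_poly to_fract h ^ a h"
      using prime_elem_dvd_prodD[OF _ prime_elem_P[OF g]] finite_P by blast
    then have "?g dvd map_poly to_fract h" using prime_elem_dvd_power prime_elem_P[OF g] by blast
    then show False using fract_dvd_in_P g h by blast
  qed
  show ?thesis using le[OF eq cd] le[OF eq[symmetric] cd(2,1)] by simp
qed

text \<open>For \<open>w \<in> Wset p f\<close> the values \<open>G(w)\<close> and \<open>H(w)\<close> are units, because \<open>F(w)\<close> is; this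
  determines the denominator of \<open>G\<close>.\<close>
lemma divisor_form:
  assumes GH: "G \<in> IntR" "H \<in> IntR" "F ^ k = G * H"
  obtains c a e where "c dvd 1" "\<And>g. g \<in> P \<Longrightarrow> a g \<le> k * m g"
    "G = smult (to_fract c) (fract_quot p e (monomial a))"
    "\<And>w. w \<in> Wset p f \<Longrightarrow> (\<Sum>g\<in>P. a g * v g w) = e"
proof -
  have "F ^ k = smult (inverse (to_fract (p ^ (k * n)))) (\<Prod>g\<in>P. map_poly to_fract g ^ (k * m g))"
    unfolding fract_quot_power
    by (simp add: fract_quot_def monomial_mult[symmetric] monomial_m[symmetric])
       (simp add: monomial_def)
  then have "G dvd smult (inverse (to_fract (p ^ (k * n)))) (\<Prod>g\<in>P. map_poly to_fract g ^ (k * m g))"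
    using GH(3) by (metis dvd_triv_left)
  then have "G dvd (\<Prod>g\<in>P. map_poly to_fract g ^ (k * m g))"
    by (rule dvd_smult_cancel) simp
  from dvd_prod_prime_powers[OF finite_P prime_elem_P this] obtain C a
    where C: "C dvd 1" "\<forall>g\<in>P. a g \<le> k * m g" "G = C * (\<Prod>g\<in>P. map_poly to_fract g ^ a g)" by blast
  obtain c where c: "C = [:c:]" "c dvd 1" using C(1) by (auto simp: is_unit_poly_iff)
  have G: "G = smult c (map_poly to_fract (monomial a))" by (simp add: C(3) c(1) monomial_def)
  \<comment> \<open>The values of \<open>G\<close> and \<open>H\<close> at \<open>w\<close> lie in
    \<open>R\<close>, and their product is \<open>d ^ k\<close> with the unit \<open>d\<close> given
    by \<open>f(w) = d * p ^ n\<close>.\<close>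
  have unit: "\<exists>s. s dvd 1 \<and> c * to_fract (poly (monomial a) w) = to_fract s" if w: "w \<in> Wset p f" for w
  proof -
    obtain s where s: "poly G (to_fract w) = to_fract s" using GH(1) unfolding IntR_def by blast
    obtain t where t: "poly H (to_fract w) = to_fract t" using GH(2) unfolding IntR_def by blast
    obtain d where d: "d dvd 1" "poly f w = d * p ^ n"
      using pmult_decomp[of "poly f w"] w unfolding Wset_iff by metis
    have "to_fract (s * t) = poly (F ^ k) (to_fract w)" by (simp add: GH(3) s t)
    also have "\<dots> = to_fract (d ^ k)" by (simp add: poly_fract_quot d(2))
    finally have "s * t = d ^ k" by (simp only: to_fract_eq_iff)
    then have "s dvd d ^ k" by (metis dvd_triv_left)
    moreover have "d ^ k dvd 1" using d(1) by (metis dvd_power_same power_one)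
    ultimately have "s dvd 1" by (rule dvd_trans)
    then show ?thesis using s by (auto simp: G)
  qed
  obtain w0 where w0: "w0 \<in> Wset p f" using Wset_nonempty by blast
  \<comment> \<open>The denominator is read off at one point: \<open>monomial a\<close> has the
    value \<open>d * p ^ e\<close> at \<open>w0\<close>, and \<open>c\<close> times this value is a
    unit \<open>s\<close>, so \<open>c\<close> is a unit divided by \<open>p ^ e\<close>.\<close>
  define e where "e = (\<Sum>g\<in>P. a g * v g w0)"
  obtain s where s: "s dvd 1" "c * to_fract (poly (monomial a) w0) = to_fract s" using unit[OF w0] by blast
  have nz: "poly (monomial a) w \<noteq> 0" if "w \<in> Wset p f" for w
    using that poly_monomial_nonzero by (simp add: Wset_iff)
  have val: "v (monomial a) w = (\<Sum>g\<in>P. a g * v g w)" if "w \<in> Wset p f" for w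
    using that pmult_monomial by (simp add: Wset_iff)
  obtain d where d: "d dvd 1" "poly (monomial a) w0 = d * p ^ e"
    using pmult_decomp[OF nz[OF w0]] val[OF w0] unfolding e_def by metis
  obtain d' where d': "1 = d * d'" using d(1) by blast
  show thesis
  proof
    show "a g \<le> k * m g" if "g \<in> P" for g using C(2) that by blast
    have "d' dvd 1" using d' by (metis dvd_triv_right)
    then show "s * d' dvd 1" using mult_dvd_mono[OF s(1)] by fastforce
    have "poly (monomial a) w0 * d' = (d * d') * p ^ e" by (simp only: d(2) mult_ac)
    then have "c * to_fract (p ^ e) = c * to_fract (poly (monomial a) w0 * d')"
      unfolding d'[symmetric] by (simp only: mult_1)
    also have "\<dots> = to_fract (s * d')" using s(2) by simp
    finally have "c = to_fract (s * d') * inverse (to_fract (p ^ e))" by (simp add: field_simps)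
    then show "G = smult (to_fract (s * d')) (fract_quot p e (monomial a))"
      by (simp add: G fract_quot_def)
    fix w assume w: "w \<in> Wset p f"
    obtain t where t: "t dvd 1" "c * to_fract (poly (monomial a) w) = to_fract t" using unit[OF w] by blast
    \<comment> \<open>Cross-multiplying eliminates \<open>c\<close>, which need not lie in
      \<open>R\<close>. As \<open>s\<close> and \<open>t\<close> are units,
      \<open>monomial a\<close> has the same valuation at \<open>w\<close> and at
      \<open>w0\<close>.\<close>
    have "to_fract (s * poly (monomial a) w) = to_fract (t * poly (monomial a) w0)"
      using s(2)[symmetric] t(2)[symmetric] by simp
    then have "s * poly (monomial a) w = t * poly (monomial a) w0" by (simp only: to_fract_eq_iff)
    moreover have "pmult p (u * x) = pmult p x" if "u dvd 1" "x \<noteq> 0" for u x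
    proof -
      have "u \<noteq> 0" using that by auto
      then show ?thesis using that pmult_unit_times_power[of u 0] by (simp add: pmult_mult)
    qed
    ultimately have "v (monomial a) w = v (monomial a) w0" using s(1) t(1) nz w w0 by metis
    then show "(\<Sum>g\<in>P. a g * v g w) = e" using val w w0 by (simp add: e_def)
  qed
qed

text \<open>If all exponents vanish, so does their weighted sum \<open>e\<close>; no power of
  \<open>p\<close> is left in the denominator and \<open>G\<close> is a unit constant.\<close>

lemma divisor_degree_0:
  assumes "G \<in> IntR" "H \<in> IntR" "F ^ k = G * H" "degree G = 0"
  shows "unit_in IntR G"
proof -
  obtain c a e where G: "c dvd 1" "G = smult (to_fract c) (fract_quot p e (monomial a))"
      "\<And>w. w \<in> Wset p f \<Longrightarrow> (\<Sum>g\<in>P. a g * v g w) = e"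
    using divisor_form[OF assms(1-3)] by metis
  have "c \<noteq> 0" using G(1) by auto
  then have a: "\<forall>g\<in>P. a g = 0"
    using assms(4) by (simp add: G(2) degree_fract_quot degree_monomial_eq_0)
  then have "e = 0" using G(3) Wset_nonempty by fastforce
  moreover have "monomial a = 1" using a by (simp add: monomial_def)
  ultimately have "G = [:to_fract c:]" by (simp add: G(2) fract_quot_def one_pCons map_poly_pCons)
  then show ?thesis using unit_in_const[OF G(1)] by simp
qed

lemma degree_F: "degree F > 0"
  using degree_f by (simp add: degree_fract_quot)

lemma F_in_IntR: "F \<in> IntR"
proof -
  have "p ^ n dvd poly f x" for x
    using pmult_f_ge[of x] by (cases "poly f x = 0") (simp_all add: power_dvd_iff)
  then show ?thesis by (simp add: fract_quot_in_IntR_iff)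
qed

text \<open>By \<open>divisor_degree_0\<close> a nontrivial splitting has two factors of positive
  degree, so induction on the degree applies.\<close>

lemma divisor_factorization:
  assumes "G \<in> IntR" "H \<in> IntR" "F ^ k = G * H" "degree G > 0"
  shows "\<exists>xs. factorization_in IntR G xs"
  using assms
proof (induction "degree G" arbitrary: G H rule: less_induct)
  case less
  have G0: "G \<noteq> 0" using less.prems(4) by auto
  have nu: "\<not> unit_in IntR G" using degree_unit_in less.prems(4) by force
  show ?case
  proof (cases "irred_in IntR G")
    case True
    then show ?thesis by (intro exI[of _ "[G]"]) (simp add: factorization_in_def)
  next
    case False
    then obtain A B where AB: "A \<in> IntR" "B \<in> IntR" "G = A * B" "\<not> unit_in IntR A" "\<not> unit_in IntR B"
      using less.prems(1) G0 nu unfolding irred_in_def by blast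
    have A: "F ^ k = A * (B * H)" and B: "F ^ k = B * (A * H)"
      using less.prems(3) by (simp_all add: AB(3) mult_ac)
    have BH: "B * H \<in> IntR" "A * H \<in> IntR" using AB less.prems IntR_mult by blast+
    have dA: "degree A > 0" and dB: "degree B > 0"
      using divisor_degree_0[OF AB(1) BH(1) A] divisor_degree_0[OF AB(2) BH(2) B] AB by auto
    have "degree G = degree A + degree B" using G0 by (simp add: AB(3) degree_mult_eq)
    then obtain xs ys where "factorization_in IntR A xs" "factorization_in IntR B ys"
      using less.hyps[OF _ AB(1) BH(1) A dA] less.hyps[OF _ AB(2) BH(2) B dB] dA dB by auto
    then show ?thesis by (intro exI[of _ "xs @ ys"]) (auto simp: factorization_in_def AB(3))
  qed
qed

section \<open>A trivial fixed divisor kernel gives unique factorization\<close>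

text \<open>The condition \<open>fdk(f) = 0\<close>. Vectors are total functions on polynomials, of
  which only the values on \<open>P\<close> count.\<close>

definition fdk_trivial :: bool where
  "fdk_trivial \<longleftrightarrow> (\<forall>u :: 'a poly \<Rightarrow> rat. (\<forall>w\<in>Wset p f. (\<Sum>g\<in>P. u g * of_nat (v g w)) = 0) \<longrightarrow>
     (\<forall>g\<in>P. u g = 0))"

text \<open>Here \<open>monomial a ^ n = f ^ e\<close>, whose values are divisible by
  \<open>p ^ (n * e)\<close>; in a valuation ring an \<open>n\<close>-th root of this divisibility
  can be taken.\<close>

lemma proportional_quot_in_IntR:
  assumes "\<And>g. g \<in> P \<Longrightarrow> n * a g = e * m g"
  shows "fract_quot p e (monomial a) \<in> IntR"
proof -
  have "monomial (\<lambda>g. n * a g) = monomial (\<lambda>g. e * m g)" using assms by (rule monomial_cong)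
  then have *: "monomial a ^ n = f ^ e" by (simp add: monomial_mult monomial_m)
  have "p ^ e dvd poly (monomial a) x" for x
  proof (rule power_dvd_power[OF _ n])
    have "p ^ n dvd poly f x" using F_in_IntR by (simp add: fract_quot_in_IntR_iff)
    then have "(p ^ n) ^ e dvd poly f x ^ e" by (rule dvd_power_same)
    then have "(p ^ n) ^ e dvd poly (monomial a ^ n) x" by (simp only: * poly_power)
    then show "p ^ (n * e) dvd poly (monomial a) x ^ n" by (simp add: power_mult)
  qed
  then show ?thesis by (simp add: fract_quot_in_IntR_iff)
qed

lemma proportional_quot_not_unit:
  assumes "\<And>g. g \<in> P \<Longrightarrow> n * a g = e * m g" "e > 0"
  shows "\<not> unit_in IntR (fract_quot p e (monomial a))"
proof
  assume "unit_in IntR (fract_quot p e (monomial a))"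
  then have "\<forall>g\<in>P. a g = 0"
    using degree_unit_in by (fastforce simp: degree_fract_quot degree_monomial_eq_0)
  then show False using assms m P_nonempty by fastforce
qed

text \<open>Of two such quotients with exponents \<open>0 < e < d\<close>, the first divides the
  second with a nonunit cofactor of the same kind. Since \<open>F\<close> is the quotient for
  \<open>e = n\<close>, neither \<open>e < n\<close> nor \<open>n < e\<close> is possible.\<close>

lemma irreducible_proportional_quot:
  assumes a: "\<And>g. g \<in> P \<Longrightarrow> n * a g = e * m g" and F: "irred_in IntR F"
    and irred: "irred_in IntR (fract_quot p e (monomial a))"
  shows "fract_quot p e (monomial a) = F"
proof -
  have split: False
    if a: "\<And>g. g \<in> P \<Longrightarrow> n * a g = e * m g" and b: "\<And>g. g \<in> P \<Longrightarrow> n * b g = d * m g"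
      and less: "0 < e" "e < d" and irred: "irred_in IntR (fract_quot p d (monomial b))" for a b e d
  proof -
    have ab: "a g \<le> b g" if "g \<in> P" for g
    proof -
      have "n * a g \<le> n * b g" using less(2) by (simp add: a[OF that] b[OF that])
      then show ?thesis using n by simp
    qed
    have c: "n * (b g - a g) = (d - e) * m g" if "g \<in> P" for g
      using a[OF that] b[OF that] by (simp add: diff_mult_distrib diff_mult_distrib2)
    have "monomial b = monomial (\<lambda>g. a g + (b g - a g))" using ab by (intro monomial_cong) simp
    then have "fract_quot p d (monomial b)
        = fract_quot p e (monomial a) * fract_quot p (d - e) (monomial (\<lambda>g. b g - a g))"
      using less by (simp add: fract_quot_mult monomial_add)
    moreover have "fract_quot p e (monomial a) \<in> IntR"
        "fract_quot p (d - e) (monomial (\<lambda>g. b g - a g)) \<in> IntR"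
      by (rule proportional_quot_in_IntR, fact a) (rule proportional_quot_in_IntR, fact c)
    moreover have "\<not> unit_in IntR (fract_quot p e (monomial a))"
      by (rule proportional_quot_not_unit[OF _ less(1)]) (fact a)
    moreover have "\<not> unit_in IntR (fract_quot p (d - e) (monomial (\<lambda>g. b g - a g)))"
      by (rule proportional_quot_not_unit) (fact c, use less in simp)
    ultimately show False using irred unfolding irred_in_def by blast
  qed
  have "e \<noteq> 0"
  proof
    assume e: "e = 0"
    then have "monomial a = 1" using a n by (simp add: monomial_def)
    then have "fract_quot p e (monomial a) = [:to_fract 1:]" by (simp add: e fract_quot_def one_pCons map_poly_pCons)
    then show False using irred unit_in_const[of "1::'a"] by (simp add: irred_in_def)
  qed
  moreover have "\<not> e < n" using split[of a e m n] a F \<open>e \<noteq> 0\<close> monomial_m by auto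
  moreover have "\<not> n < e" using split[of m n a e] a irred n by auto
  ultimately have e: "e = n" by simp
  then have "monomial a = monomial m" using a n by (intro monomial_cong) auto
  then show ?thesis by (simp add: e monomial_m)
qed

lemma fdk_trivial_imp_assoc:
  assumes trivial: fdk_trivial and F: "irred_in IntR F"
    and xs: "factorization_in IntR (F ^ k) xs" and G: "G \<in> set xs"
  shows "assoc_in IntR G F"
proof -
  have irr: "\<forall>x\<in>set xs. irred_in IntR x" and prod: "prod_list xs = F ^ k"
    using xs by (auto simp: factorization_in_def)
  then have xs_IntR: "set xs \<subseteq> IntR" by (auto simp: irred_in_def)
  obtain H where H: "H \<in> IntR" "F ^ k = G * H"
  proof -
    obtain ys zs where yz: "xs = ys @ G # zs" using G by (metis split_list)
    show thesis
      by (rule that[of "prod_list (ys @ zs)"])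
         (use xs_IntR prod yz in \<open>auto simp: mult_ac simp del: prod_list.append intro!: IntR_prod_list\<close>,
          simp add: yz mult_ac flip: prod)
  qed
  have "G \<in> IntR" using G xs_IntR by blast
  from divisor_form[OF this H] obtain c a e where c: "c dvd 1"
      and G_eq: "G = smult (to_fract c) (fract_quot p e (monomial a))"
      and e: "\<And>w. w \<in> Wset p f \<Longrightarrow> (\<Sum>g\<in>P. a g * v g w) = e" by metis
  \<comment> \<open>Both terms of \<open>n a - e m\<close> pair with the row of any \<open>w\<close>
    in \<open>Wset p f\<close> to \<open>n * e\<close>, so \<open>u\<close> lies in
    \<open>fdk(f)\<close>.\<close>
  define u :: "'a poly \<Rightarrow> rat" where "u g = of_nat (n * a g) - of_nat (e * m g)" for g
  have "(\<Sum>g\<in>P. u g * of_nat (v g w)) = 0" if w: "w \<in> Wset p f" for w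
  proof -
    have "(\<Sum>g\<in>P. u g * of_nat (v g w))
        = of_nat n * of_nat (\<Sum>g\<in>P. a g * v g w) - of_nat e * of_nat (\<Sum>g\<in>P. m g * v g w)"
      by (simp add: u_def algebra_simps sum_subtractf sum_distrib_left)
    also have "(\<Sum>g\<in>P. m g * v g w) = n" using w pmult_f[of w] by (simp add: Wset_iff)
    finally show ?thesis using e[OF w] by simp
  qed
  then have "\<forall>g\<in>P. u g = 0" using trivial by (auto simp: fdk_trivial_def)
  then have a: "n * a g = e * m g" if "g \<in> P" for g
    using that unfolding u_def by (metis eq_iff_diff_eq_0 of_nat_eq_iff)
  define Q where "Q = fract_quot p e (monomial a)"
  have unit: "unit_in IntR [:to_fract c:]" using c by (rule unit_in_const)
  have G_Q: "G = [:to_fract c:] * Q" by (simp add: G_eq Q_def)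
  \<comment> \<open>Irreducibility carries over from \<open>G\<close>, which differs from
    \<open>Q\<close> by a unit constant.\<close>
  have "irred_in IntR Q"
    unfolding irred_in_def
  proof (intro conjI ballI impI)
    show "Q \<in> IntR" unfolding Q_def using a by (rule proportional_quot_in_IntR)
    show "Q \<noteq> 0" using G irr G_Q by (auto simp: irred_in_def)
    show "\<not> unit_in IntR Q" using G irr G_Q unit_in_mult[OF unit] by (auto simp: irred_in_def)
    fix A B assume AB: "A \<in> IntR" "B \<in> IntR" "Q = A * B"
    then have "G = A * ([:to_fract c:] * B)" by (simp add: G_Q)
    moreover have "[:to_fract c:] * B \<in> IntR" using unit AB IntR_mult unfolding unit_in_def by blast
    ultimately have "unit_in IntR A \<or> unit_in IntR ([:to_fract c:] * B)"
      using G irr AB unfolding irred_in_def by blast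
    moreover obtain C where C: "unit_in IntR C" "C * [:to_fract c:] = 1"
      using unit_in_inverse[OF unit] by (metis mult.commute)
    have "B = C * ([:to_fract c:] * B)" unfolding mult.assoc[symmetric] C(2) by simp
    then have "unit_in IntR B" if "unit_in IntR ([:to_fract c:] * B)"
      using unit_in_mult[OF C(1) that] by metis
    ultimately show "unit_in IntR A \<or> unit_in IntR B" by blast
  qed
  then have "Q = F" using irreducible_proportional_quot[OF a F] unfolding Q_def by blast
  then show ?thesis using G_Q unit unfolding assoc_in_def by blast
qed

section \<open>A nonzero kernel vector destroys unique factorization\<close>

text \<open>On \<open>Wset p f\<close> the perturbation \<open>z\<close> does not change the
  valuation \<open>k * n\<close>. Elsewhere \<open>V = v(f(x))\<close> is at least
  \<open>n + 1\<close>, and \<open>z\<close> costs at most \<open>b * V\<close>. The choice of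
  \<open>k\<close> leaves \<open>k * V - b * V = b * n * V\<close>, which is at least
  \<open>b * n * (n + 1) = k * n\<close>.\<close>

lemma perturbed_quot_in_IntR:
  fixes z :: "'a poly \<Rightarrow> int"
  assumes z: "\<And>g. g \<in> P \<Longrightarrow> \<bar>z g\<bar> \<le> int b" and b: "b \<ge> 1"
    and ker: "\<And>w. w \<in> Wset p f \<Longrightarrow> (\<Sum>g\<in>P. z g * int (v g w)) = 0"
    and k: "k = (n + 1) * b"
  shows "fract_quot p (k * n) (monomial (\<lambda>g. nat (int (k * m g) + z g))) \<in> IntR"
proof -
  have pos: "int (k * m g) + z g > 0" if "g \<in> P" for g
  proof -
    have "k \<le> k * m g" using m[OF that] by simp
    then have "int k \<le> int (k * m g)" by (simp only: of_nat_le_iff)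
    moreover have "int b < int k" using n b by (simp add: k)
    ultimately show ?thesis using z[OF that] by linarith
  qed
  have "p ^ (k * n) dvd poly (monomial (\<lambda>g. nat (int (k * m g) + z g))) x" for x
  proof (cases "poly f x = 0")
    \<comment> \<open>At a root of \<open>f\<close> the value must be 0 as well; this holds since
      all perturbed exponents are positive.\<close>
    case True
    then obtain g where g: "g \<in> P" "poly g x = 0"
      using finite_P by (subst (asm) f) (auto simp: poly_prod)
    then have "poly g x ^ nat (int (k * m g) + z g) = 0" using pos[OF g(1)] by simp
    then have "poly (monomial (\<lambda>g. nat (int (k * m g) + z g))) x = 0"
      unfolding poly_monomial using g(1) finite_P by (intro prod_zero) blast+
    then show ?thesis by simp
  next
    case False
    define V where "V = v f x"
    have V: "V = (\<Sum>g\<in>P. m g * v g x)" using pmult_f[OF False] by (simp add: V_def)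
    define Z where "Z = (\<Sum>g\<in>P. z g * int (v g x))"
    have "int (v (monomial (\<lambda>g. nat (int (k * m g) + z g))) x)
        = (\<Sum>g\<in>P. (int (k * m g) + z g) * int (v g x))"
      unfolding pmult_monomial[OF False] of_nat_sum
      by (intro sum.cong) (use pos in \<open>auto intro: less_imp_le\<close>)
    also have "\<dots> = int k * int V + Z"
      by (simp add: V Z_def algebra_simps sum.distrib sum_distrib_left)
    finally have val: "int (v (monomial (\<lambda>g. nat (int (k * m g) + z g))) x) = int k * int V + Z" .
    have "int (k * n) \<le> int k * int V + Z"
    proof (cases "V = n")
      case True
      then have "x \<in> Wset p f" using False by (simp add: Wset_iff V_def)
      then show ?thesis using ker True by (simp add: Z_def)
    next
      case neq: False
      have "\<bar>Z\<bar> \<le> (\<Sum>g\<in>P. \<bar>z g\<bar> * int (v g x))"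
        unfolding Z_def by (rule order_trans[OF sum_abs]) (simp add: abs_mult)
      also have "\<dots> \<le> (\<Sum>g\<in>P. int b * (int (m g) * int (v g x)))"
      proof (rule sum_mono)
        fix g assume g: "g \<in> P"
        have "1 * int (v g x) \<le> int (m g) * int (v g x)" using m[OF g] by (intro mult_right_mono) auto
        then show "\<bar>z g\<bar> * int (v g x) \<le> int b * (int (m g) * int (v g x))"
          using z[OF g] by (intro mult_mono) auto
      qed
      also have "\<dots> = int b * int V" by (simp add: V sum_distrib_left)
      finally have Z: "\<bar>Z\<bar> \<le> int b * int V" .
      have "n + 1 \<le> V" using pmult_f_ge[OF False] neq by (simp add: V_def)
      then have "b * n * (n + 1) \<le> b * n * V" by (rule mult_le_mono2)
      then have "int (k * n) \<le> int (b * n) * int V"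
        unfolding k of_nat_mult[symmetric] of_nat_le_iff by (simp only: mult_ac)
      also have "\<dots> = int k * int V - int b * int V" by (simp add: k algebra_simps)
      finally show ?thesis using Z by linarith
    qed
    then have "k * n \<le> v (monomial (\<lambda>g. nat (int (k * m g) + z g))) x"
      unfolding val[symmetric] of_nat_le_iff .
    then show ?thesis using poly_monomial_nonzero[OF False] by (simp add: power_dvd_iff)
  qed
  then show ?thesis by (simp add: fract_quot_in_IntR_iff)
qed

text \<open>The exponents \<open>k m + z\<close> and \<open>k m - z\<close> add up to
  \<open>2 k m\<close>, so \<open>G * H\<close> is \<open>F ^ (2 * k)\<close>. Unique factorization
  would make \<open>G\<close> a constant times a power of \<open>F\<close>, and \<open>z\<close> a
  multiple of \<open>m\<close>.\<close>

lemma kernel_vector_imp_not_unique: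
  fixes z :: "'a poly \<Rightarrow> int"
  assumes F: "irred_in IntR F" and z: "\<And>g. g \<in> P \<Longrightarrow> \<bar>z g\<bar> \<le> int b" and b: "b \<ge> 1"
    and ker: "\<And>w. w \<in> Wset p f \<Longrightarrow> (\<Sum>g\<in>P. z g * int (v g w)) = 0"
    and nonzero: "h \<in> P" "z h \<noteq> 0"
  shows "\<not> factors_uniquely_in IntR (F ^ (2 * (n + 1) * b))"
proof
  assume unique: "factors_uniquely_in IntR (F ^ (2 * (n + 1) * b))"
  define k where "k = (n + 1) * b"
  define a where "a g = nat (int (k * m g) + z g)" for g
  define a' where "a' g = nat (int (k * m g) + - z g)" for g
  define G where "G = fract_quot p (k * n) (monomial a)"
  define H where "H = fract_quot p (k * n) (monomial a')"
  have G: "G \<in> IntR" and H: "H \<in> IntR"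
    unfolding G_def H_def a_def a'_def
    using perturbed_quot_in_IntR[of z b k] perturbed_quot_in_IntR[of "\<lambda>g. - z g" b k] z b ker
    by (simp_all add: k_def sum_negf)
  have pos: "\<bar>z g\<bar> < int (k * m g)" if "g \<in> P" for g
  proof -
    have "k \<le> k * m g" using m[OF that] by simp
    then have "int k \<le> int (k * m g)" by (simp only: of_nat_le_iff)
    moreover have "int b < int k" using n b by (simp add: k_def)
    ultimately show ?thesis using z[OF that] by linarith
  qed
  have a: "int (a g) = int (k * m g) + z g" "int (a' g) = int (k * m g) - z g" if "g \<in> P" for g
    using pos[OF that] by (auto simp: a_def a'_def)
  have "monomial (\<lambda>g. a g + a' g) = monomial (\<lambda>g. 2 * k * m g)"
  proof (rule monomial_cong)
    fix g assume "g \<in> P"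
    with a[OF this] have "int (a g + a' g) = int (2 * k * m g)" by simp
    then show "a g + a' g = 2 * k * m g" by (simp only: of_nat_eq_iff)
  qed
  then have "G * H = F ^ (2 * k)"
    by (simp add: G_def H_def fract_quot_mult fract_quot_power monomial_mult monomial_m
        flip: monomial_add) (simp add: mult_2[symmetric] mult_ac)
  then have GH: "F ^ (2 * k) = G * H" "F ^ (2 * k) = H * G" by (simp_all add: mult.commute)
  have "a h \<noteq> 0" "a' h \<noteq> 0" using a[OF nonzero(1)] pos[OF nonzero(1)] by auto
  then have "degree G > 0" "degree H > 0"
    using nonzero(1) degree_monomial_eq_0[of a] degree_monomial_eq_0[of a']
    by (auto simp: G_def H_def degree_fract_quot)
  then obtain xs ys where xy: "factorization_in IntR G xs" "factorization_in IntR H ys"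
    using divisor_factorization[OF G H GH(1)] divisor_factorization[OF H G GH(2)] by blast
  then have "factorization_in IntR (F ^ (2 * k)) (xs @ ys)"
    by (auto simp: factorization_in_def GH(1))
  then have "\<forall>A\<in>set (xs @ ys). assoc_in IntR A F"
    using unique factors_uniquely_iff_assoc[OF F degree_F, of "2 * k"]
    unfolding k_def mult.assoc[symmetric] by blast
  then have "\<forall>A\<in>set xs. assoc_in IntR A F" by simp
  from prod_list_assoc[OF this] obtain c where c: "c \<noteq> 0" "G = smult c (F ^ length xs)"
    using xy(1) by (auto simp: factorization_in_def)
  define i where "i = length xs"
  have "smult (inverse (to_fract (p ^ (k * n)))) (map_poly to_fract (monomial a))
      = smult (c * inverse (to_fract (p ^ (i * n)))) (map_poly to_fract (monomial (\<lambda>g. i * m g)))"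
    using c(2) unfolding G_def fract_quot_power monomial_mult monomial_m i_def[symmetric]
    by (simp add: fract_quot_def)
  then have ai: "a g = i * m g" if "g \<in> P" for g
    by (rule monomial_inj[where g = g]) (use c(1) that in auto)
  have zi: "z g = (int i - int k) * int (m g)" if "g \<in> P" for g
    using a(1)[OF that] ai[OF that] by (simp add: algebra_simps)
  \<comment> \<open>The vector \<open>m\<close> pairs with the row of \<open>w\<close> to
    \<open>n\<close>, which is not 0; so the only multiple of \<open>m\<close> in the kernel is
    0.\<close>
  obtain w where w: "w \<in> Wset p f" using Wset_nonempty by blast
  have "0 = (\<Sum>g\<in>P. (int i - int k) * int (m g) * int (v g w))" using ker[OF w] zi by simp
  also have "\<dots> = (int i - int k) * int (\<Sum>g\<in>P. m g * v g w)"
    by (simp add: sum_distrib_left mult.assoc)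
  also have "(\<Sum>g\<in>P. m g * v g w) = n" using w pmult_f[of w] by (simp add: Wset_iff)
  finally have "int i = int k" using n by simp
  then show False using zi nonzero by simp
qed

end

subsection \<open>The rank of the valuation matrix\<close>

context discrete_valuation
begin

text \<open>Representatives modulo \<open>p ^ Suc t\<close> are built digit by digit as
  \<open>d + p * e\<close>, with \<open>d\<close> from a system modulo \<open>p\<close> and
  \<open>e\<close> from one modulo \<open>p ^ t\<close>.\<close>

lemma residue_representatives:
  assumes "finite (UNIV // resrel p)"
  shows "\<exists>D. finite D \<and> card D \<le> card (UNIV // resrel p) ^ t \<and> (\<forall>x. \<exists>d\<in>D. p ^ t dvd x - d)"
proof (induction t)
  case 0
  show ?case by (intro exI[of _ "{0}"]) simp
next
  case (Suc t)
  then obtain E where E: "finite E" "card E \<le> card (UNIV // resrel p) ^ t" "\<forall>x. \<exists>e\<in>E. p ^ t dvd x - e"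
    by blast
  define D where "D = (\<lambda>C. SOME x. x \<in> C) ` (UNIV // resrel p)"
  have D: "finite D" "card D \<le> card (UNIV // resrel p)"
    unfolding D_def using assms card_image_le by auto
  have rep: "\<exists>d\<in>D. p dvd x - d" for x
  proof -
    let ?C = "resrel p `` {x}"
    have "?C \<in> UNIV // resrel p" by (rule quotientI) simp
    then have "(SOME y. y \<in> ?C) \<in> D" unfolding D_def by (rule imageI)
    moreover have "x \<in> ?C" by (simp add: resrel_def)
    then have "(SOME y. y \<in> ?C) \<in> ?C" by (rule someI)
    ultimately show ?thesis by (auto simp: resrel_def)
  qed
  define E' where "E' = (\<lambda>(d, e). d + p * e) ` (D \<times> E)"
  have "card E' \<le> card D * card E"
    unfolding E'_def using card_image_le[of "D \<times> E"] D(1) E(1) by (simp add: card_cartesian_product)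
  also have "\<dots> \<le> card (UNIV // resrel p) ^ Suc t" using mult_le_mono[OF D(2) E(2)] by simp
  finally have "card E' \<le> card (UNIV // resrel p) ^ Suc t" .
  moreover have "\<exists>e\<in>E'. p ^ Suc t dvd x - e" for x
  proof -
    obtain d where d: "d \<in> D" "p dvd x - d" using rep by blast
    then obtain y where y: "x - d = p * y" by blast
    obtain e where e: "e \<in> E" "p ^ t dvd y - e" using E(3) by blast
    have "x - (d + p * e) = p * (y - e)" using y by (simp add: algebra_simps)
    then have "p ^ Suc t dvd x - (d + p * e)" using e(2) by (simp add: mult_dvd_mono)
    moreover have "d + p * e \<in> E'" using d e by (force simp: E'_def)
    ultimately show ?thesis by blast
  qed
  moreover have "finite E'" using D E by (simp add: E'_def)
  ultimately show ?case by blast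
qed

lemma card_incongruent_le:
  assumes "finite (UNIV // resrel p)"
    and "\<And>w w'. w \<in> W \<Longrightarrow> w' \<in> W \<Longrightarrow> p ^ t dvd w - w' \<Longrightarrow> w = w'"
  shows "card W \<le> card (UNIV // resrel p) ^ t"
proof -
  obtain D where D: "finite D" "card D \<le> card (UNIV // resrel p) ^ t" "\<forall>x. \<exists>d\<in>D. p ^ t dvd x - d"
    using residue_representatives[OF assms(1)] by blast
  then obtain h where h: "\<And>x. h x \<in> D" "\<And>x. p ^ t dvd x - h x" by metis
  have "inj_on h W"
  proof (rule inj_onI)
    fix x y assume xy: "x \<in> W" "y \<in> W" "h x = h y"
    have "p ^ t dvd (x - h x) - (y - h y)" by (rule dvd_diff[OF h(2) h(2)])
    then show "x = y" using assms(2) xy by simp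
  qed
  then have "card W \<le> card D" using h(1) D(1) by (intro card_inj_on_le[of h]) auto
  with D(2) show ?thesis by simp
qed

end

section \<open>Rows of the valuation matrix modulo powers of p\<close>

context int_valued_quotient
begin

lemma sum_P_Wset: "w \<in> Wset p f \<Longrightarrow> (\<Sum>g\<in>P. m g * v g w) = n"
  using pmult_f[of w] by (simp add: Wset_iff)

lemma sum_v_le:
  assumes "w \<in> Wset p f"
  shows "(\<Sum>g\<in>P. v g w) \<le> n"
proof -
  have "1 * v g w \<le> m g * v g w" if "g \<in> P" for g using m[OF that] by (intro mult_le_mono1)
  then have "(\<Sum>g\<in>P. v g w) \<le> (\<Sum>g\<in>P. m g * v g w)" by (intro sum_mono) simp
  then show ?thesis by (simp add: sum_P_Wset[OF assms])
qed

text \<open>If two rows differ, they differ in opposite directions at two places, because both have the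
  same weighted sum \<open>n\<close>. At both places the smaller value is at least \<open>t\<close>.\<close>
lemma v_cong:
  assumes w: "w \<in> Wset p f" "w' \<in> Wset p f" and cong: "p ^ t dvd w - w'" and t: "n \<le> 2 * t"
    and g: "g \<in> P"
  shows "v g w = v g w'"
proof -
  \<comment> \<open>If the smaller value \<open>v h x\<close> were below \<open>t\<close>, then
    \<open>p ^ Suc (v h x)\<close> would divide both \<open>h(x) - h(y)\<close> and
    \<open>h(y)\<close>, hence \<open>h(x)\<close>.\<close>
  have ge: "t \<le> v h x"
    if "h \<in> P" "x \<in> Wset p f" "y \<in> Wset p f" "p ^ t dvd x - y" "v h x < v h y" for h x y
  proof (rule ccontr)
    assume less: "\<not> t \<le> v h x"
    have nz: "poly h x \<noteq> 0" "poly h y \<noteq> 0" using that poly_nonzero_P by (auto simp: Wset_iff)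
    have "p ^ Suc (v h x) dvd p ^ t" using less by (intro le_imp_power_dvd) simp
    also have "\<dots> dvd poly h x - poly h y"
      using that(4) diff_dvd_poly_diff by (rule dvd_trans)
    finally have "p ^ Suc (v h x) dvd poly h x - poly h y" .
    moreover have "p ^ Suc (v h x) dvd poly h y" using that(5) power_dvd_iff[OF nz(2)] Suc_leI by blast
    ultimately have "p ^ Suc (v h x) dvd (poly h x - poly h y) + poly h y" by (rule dvd_add)
    then show False using power_dvd_iff[OF nz(1), of "Suc (v h x)"] by simp
  qed
  have le: "v g y \<le> v g x" if xy: "x \<in> Wset p f" "y \<in> Wset p f" "p ^ t dvd x - y" for x y
  proof (rule ccontr)
    assume "\<not> v g y \<le> v g x"
    then have less: "v g x < v g y" by simp
    have "\<exists>h\<in>P. v h y < v h x"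
    proof (rule ccontr)
      assume "\<not> (\<exists>h\<in>P. v h y < v h x)"
      then have "(\<Sum>h\<in>P. m h * v h x) < (\<Sum>h\<in>P. m h * v h y)"
        using finite_P g less m[OF g] by (intro sum_strict_mono_ex1) (auto simp: not_less intro!: bexI[of _ g])
      then show False by (simp add: sum_P_Wset xy)
    qed
    then obtain h where h: "h \<in> P" "v h y < v h x" by blast
    have "p ^ t dvd y - x" using xy(3) by (metis dvd_minus_iff minus_diff_eq)
    then have "t \<le> v h y" using ge[OF h(1) xy(2,1) _ h(2)] by simp
    \<comment> \<open>Strictness matters: together with \<open>t <= v h y\<close>, the row of
      \<open>y\<close> has sum above \<open>2 * t\<close>, hence above \<open>n\<close>.\<close>
    moreover have "t < v g y" using ge[OF g xy less] less by simp
    moreover have "g \<noteq> h" using h(2) less by auto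
    then have "v g y + v h y = (\<Sum>k\<in>{g, h}. v k y)" by simp
    moreover have "(\<Sum>k\<in>{g, h}. v k y) \<le> (\<Sum>k\<in>P. v k y)"
      using finite_P g h by (intro sum_mono2) auto
    ultimately show False using sum_v_le[OF xy(2)] t by linarith
  qed
  have "p ^ t dvd w' - w" using cong by (metis dvd_minus_iff minus_diff_eq)
  then show ?thesis using le[OF w cong] le[OF w(2,1)] by simp
qed

text \<open>Elements congruent modulo \<open>p ^ t\<close> have equal rows by \<open>v_cong\<close>,
  so independence makes the elements of \<open>W\<close> pairwise incongruent.\<close>

lemma card_rows_le:
  assumes fin: "finite (UNIV // resrel p)" "finite W" and W: "W \<subseteq> Wset p f"
    and indep: "rows_indep (vmat p) W P" and t: "n \<le> 2 * t"
  shows "card W \<le> card (UNIV // resrel p) ^ t"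
proof (rule card_incongruent_le[OF fin(1)], rule ccontr)
  fix w w' assume w: "w \<in> W" "w' \<in> W" and cong: "p ^ t dvd w - w'" and neq: "w \<noteq> w'"
  have "vmat p w g = vmat p w' g" if "g \<in> P" for g
    using v_cong[OF _ _ cong t that] w W by (auto simp: vmat_def)
  then have "(1::rat) = 0"
    by (intro rows_indep_two_rows(1)[OF indep fin(2) w neq, of 1 "-1"]) simp
  then show False by simp
qed

section \<open>The criterion for absolute irreducibility\<close>

lemma unique_imp_fdk_trivial:
  assumes W: "finite W" "W \<subseteq> Wset p f" "rows_indep (vmat p) W P"
    and ker: "\<And>u :: 'a poly \<Rightarrow> rat. (\<forall>w\<in>W. (\<Sum>g\<in>P. vmat p w g * u g) = 0) \<longleftrightarrow>
      (\<forall>a\<in>Wset p f. (\<Sum>g\<in>P. u g * of_nat (v g a)) = 0)"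
    and F: "irred_in IntR F"
    and b: "card W - card {w\<in>W. card {g\<in>P. vmat p w g \<noteq> 0} = 1} \<le> b"
    and unique: "factors_uniquely_in IntR (F ^ (2 * (n + 1) * n ^ b))"
  shows fdk_trivial
proof (rule ccontr)
  assume "\<not> fdk_trivial"
  then obtain u :: "'a poly \<Rightarrow> rat" and k
    where u: "\<forall>a\<in>Wset p f. (\<Sum>g\<in>P. u g * of_nat (v g a)) = 0" and k: "k \<in> P" "u k \<noteq> 0"
    by (auto simp: fdk_trivial_def)
  have vmat: "vmat p = (\<lambda>w g. of_nat (v g w))" by (simp add: vmat_def fun_eq_iff)
  obtain z :: "'a poly \<Rightarrow> int" where z: "\<exists>h\<in>P. z h \<noteq> 0"
    "\<And>g. \<bar>z g\<bar> \<le> int (n ^ (card W - card {w\<in>W. card {g\<in>P. v g w \<noteq> 0} = 1}))"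
    "\<And>w. w \<in> W \<Longrightarrow> (\<Sum>g\<in>P. int (v g w) * z g) = 0"
  proof (rule small_integer_kernel_vector_rank[OF W(1) finite_P W(3)[unfolded vmat], of u k n])
    fix w assume w: "w \<in> W"
    show "(\<Sum>g\<in>P. of_nat (v g w) * u g) = 0"
      using ker[of u] u w unfolding vmat by blast
    show "(\<Sum>g\<in>P. v g w) \<le> n" using sum_v_le w W(2) by blast
  qed (use k n in auto)
  \<comment> \<open>The pigeonhole argument controls only the finitely many rows in
    \<open>W\<close>; the hypothesis \<open>ker\<close> transfers the equations to all of
    \<open>Wset p f\<close>.\<close>
  have "\<forall>w\<in>W. (\<Sum>g\<in>P. vmat p w g * of_int (z g)) = 0"
  proof
    fix w assume "w \<in> W"
    then have "rat_of_int (\<Sum>g\<in>P. int (v g w) * z g) = 0" using z(3) by simp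
    then show "(\<Sum>g\<in>P. vmat p w g * of_int (z g)) = 0" by (simp add: vmat)
  qed
  then have ker_Wset: "(\<Sum>g\<in>P. of_int (z g) * rat_of_nat (v g a)) = 0" if "a \<in> Wset p f" for a
    using ker[of "\<lambda>g. of_int (z g)"] that by blast
  have "(\<Sum>g\<in>P. z g * int (v g a)) = 0" if "a \<in> Wset p f" for a
  proof -
    have "rat_of_int (\<Sum>g\<in>P. z g * int (v g a)) = 0" using ker_Wset[OF that] by simp
    then show ?thesis by (simp only: of_int_eq_0_iff)
  qed
  moreover have "\<bar>z g\<bar> \<le> int (n ^ b)" for g
  proof -
    have "n ^ (card W - card {w\<in>W. card {g\<in>P. v g w \<noteq> 0} = 1}) \<le> n ^ b"
      using b n by (intro power_increasing) (simp_all add: vmat)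
    then show ?thesis using z(2)[of g] by linarith
  qed
  ultimately show False
    using kernel_vector_imp_not_unique[OF F, of z "n ^ b"] z(1) n unique by auto
qed

lemma fdk_trivial_imp_abs_irred:
  assumes fdk_trivial "irred_in IntR F"
  shows "abs_irred_in IntR F"
  using assms fdk_trivial_imp_assoc[OF assms] factors_uniquely_iff_assoc[OF assms(2) degree_F]
  unfolding abs_irred_in_def by blast

end

theorem theorem3:
  fixes p :: "'a::idom" and f :: "'a poly" and P :: "'a poly set" and m :: "'a poly \<Rightarrow> nat"
    and n :: nat and W :: "'a set"
  assumes "dvr p"
    and "finite (UNIV // resrel p)"
    and "degree f > 0" and "primitive f"
    and "irr_divisor_set f P"
    and "\<forall>g\<in>P. m g \<ge> 1" and "f = (\<Prod>g\<in>P. g ^ m g)"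
    and "vd p f = enat n" and "n \<ge> 1"
    and "finite W" and "W \<subseteq> Wset p f"
    and "rows_indep (vmat p) W P"
    and "\<forall>u :: 'a poly \<Rightarrow> rat.
           (\<forall>w\<in>W. (\<Sum>g\<in>P. vmat p w g * u g) = 0) \<longleftrightarrow>
           (\<forall>a\<in>Wset p f. (\<Sum>g\<in>P. u g * of_nat (pmult p (poly g a))) = 0)"
    and "irred_in IntR (smult (inverse (to_fract (p ^ n))) (map_poly to_fract f))"
  shows "let F = smult (inverse (to_fract (p ^ n))) (map_poly to_fract f);
             q = card (UNIV // resrel p);
             u = card {w\<in>W. card {g\<in>P. vmat p w g \<noteq> 0} = 1};
             S1 = 2 * (n + 1) * n ^ (q ^ nat \<lceil>real n / 2\<rceil>);
             S2 = 2 * (n + 1) * n ^ (mat_rank (vmat p) W P - u)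
         in (abs_irred_in IntR F \<longleftrightarrow> factors_uniquely_in IntR (F ^ S1)) \<and>
            (factors_uniquely_in IntR (F ^ S1) \<longleftrightarrow> factors_uniquely_in IntR (F ^ S2))"
proof -
  interpret int_valued_quotient p f P m n
    by standard (use assms in auto)
  define u where "u = card {w\<in>W. card {g\<in>P. vmat p w g \<noteq> 0} = 1}"
  define t where "t = nat \<lceil>real n / 2\<rceil>"
  \<comment> \<open>The ceiling of \<open>n / 2\<close> is the least precision \<open>t\<close> to
    which \<open>v_cong\<close> applies.\<close>
  have "n \<le> 2 * t" unfolding t_def by linarith
  then have "card W \<le> card (UNIV // resrel p) ^ t"
    using card_rows_le assms by blast
  then have bound: "card W - u \<le> card (UNIV // resrel p) ^ t" by simp
  have irred: "irred_in IntR F" using assms(14) by (simp only: fract_quot_def)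
  have rank: "mat_rank (vmat p) W P = card W" using assms by (intro rows_indep_mat_rank)
  \<comment> \<open>A general exponent \<open>b\<close> at least \<open>rank A - u\<close> serves
    both criteria: it is later taken to be \<open>q ^ t\<close> and \<open>rank A - u\<close>
    itself.\<close>
  have unique: "abs_irred_in IntR F"
    if "factors_uniquely_in IntR (F ^ (2 * (n + 1) * n ^ b))" "card W - u \<le> b" for b
    using unique_imp_fdk_trivial[OF assms(10-12) _ irred _ that(1)] that(2) assms(13) irred
      fdk_trivial_imp_abs_irred unfolding u_def by blast
  have abs: "factors_uniquely_in IntR (F ^ k)" if "abs_irred_in IntR F" for k
    using that by (simp add: abs_irred_in_def)
  show ?thesis
    unfolding Let_def fract_quot_def[symmetric] u_def[symmetric] t_def[symmetric] rank
    using unique[OF _ bound] unique[OF _ order_refl] abs by blast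
qed

end
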